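(* Let $X$ be a compact metric space, $\varepsilon>0$, and $c\in C(X\times X;[0,\infty))$ symmetric such that $k_c=\exp(-c/\varepsilon)$ is a positive definite universal kernel. Let $\mu\in\mathcal{P}(X)$ and $\dot\beta\in\mathcal{H}_c$ with $\langle B(\mu),\dot\beta\rangle_{\mathcal{H}_c}=0$. Then $$\frac\varepsilon2\|\dot\beta\|_{\mathcal{H}_c}^2\le\tilde{\mathbf{g}}_\mu(\dot\beta,\dot\beta)\le C\,\frac\varepsilon2\|\dot\beta\|_{\mathcal{H}_c}^2\qquad\text{for } C=1+2\exp\left(\frac{11}{2\varepsilon}\|c\|_\infty\right).$$
   Context: $\mathcal{P}(X)$: Radon probability measures. A kernel is universal if its reproducing kernel Hilbert space (RKHS) is dense in $C(X)$. For $\mu\in\mathcal{P}(X)$, $f_{\mu,\mu}\in C(X)$ is the unique function with $\int_X\exp\left(\frac1\varepsilon(f_{\mu,\mu}(x)+f_{\mu,\mu}(y)-c(x,y))\right)d\mu(x)=1$ for all $y\in X$; $a_\mu=\exp(f_{\mu,\mu}/\varepsilon)$; $k_\mu(x,y)=a_\mu(x)a_\mu(y)k_c(x,y)$; $K_\mu[\phi](y)=\int_X\phi(x)k_\mu(x,y)\,d\mu(x)$. $\mathcal{H}_c$ is the RKHS of $k_c$ and $B(\mu)=\int_X a_\mu(x)k_c(x,\cdot)\,d\mu(x)=\exp(-f_{\mu,\mu}/\varepsilon)\in\mathcal{H}_c$. For $\dot\beta\in\mathcal{H}_c$ with $\langle B(\mu),\dot\beta\rangle_{\mathcal{H}_c}=0$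 (equivalently $\int a_\mu\dot\beta\,d\mu=0$), $$\tilde{\mathbf{g}}_\mu(\dot\beta,\dot\beta)=\frac\varepsilon2\left(\|\dot\beta\|_{\mathcal{H}_c}^2+2\left\langle a_\mu\dot\beta,(\mathrm{id}-K_\mu)^{-1}[a_\mu\dot\beta]\right\rangle_{L^2(X,\mu)}\right),$$ where $(\mathrm{id}-K_\mu)^{-1}$ is taken on $L^2(X,\mu)/\mathbb{R}$ (quotient by constants), on which $\mathrm{id}-K_\mu$ is boundedly invertible; the pairing is well defined since $a_\mu\dot\beta$ has zero $\mu$-mean. *)

theory Defs
  imports "HOL-Probability.Probability"
begin

section \<open>Kernels and reproducing kernel Hilbert spaces\<close>

definition pos_def_kernel :: "('a \<Rightarrow> 'a \<Rightarrow> real) \<Rightarrow> bool" where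
  "pos_def_kernel k \<longleftrightarrow>
     (\<forall>x y. k x y = k y x) \<and>
     (\<forall>S w. finite S \<longrightarrow> 0 \<le> (\<Sum>x\<in>S. \<Sum>y\<in>S. w x * w y * k x y))"

text \<open>
  \<open>rkhs k H ip\<close>: the set of functions \<open>H\<close> with inner product \<open>ip\<close> is the reproducing
  kernel Hilbert space of \<open>k\<close>. By Moore--Aronszajn, a positive definite \<open>k\<close> determines
  \<open>H\<close>, and \<open>ip\<close> on \<open>H\<close>, uniquely; values of \<open>ip\<close> outside \<open>H\<close> are irrelevant.
\<close>

locale rkhs =
  fixes k :: "'a \<Rightarrow> 'a \<Rightarrow> real"
    and H :: "('a \<Rightarrow> real) set"
    and ip :: "('a \<Rightarrow> real) \<Rightarrow> ('a \<Rightarrow> real) \<Rightarrow> real"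
  assumes zero_mem: "(\<lambda>x. 0) \<in> H"
    and add_mem: "\<And>f g. f \<in> H \<Longrightarrow> g \<in> H \<Longrightarrow> (\<lambda>x. f x + g x) \<in> H"
    and scale_mem: "\<And>f r. f \<in> H \<Longrightarrow> (\<lambda>x. r * f x) \<in> H"
    and ip_commute: "\<And>f g. f \<in> H \<Longrightarrow> g \<in> H \<Longrightarrow> ip f g = ip g f"
    and ip_add_left: "\<And>f g h. f \<in> H \<Longrightarrow> g \<in> H \<Longrightarrow> h \<in> H \<Longrightarrow>
           ip (\<lambda>x. f x + g x) h = ip f h + ip g h"
    and ip_scale_left: "\<And>f g r. f \<in> H \<Longrightarrow> g \<in> H \<Longrightarrow> ip (\<lambda>x. r * f x) g = r * ip f g"
    and ip_nonneg: "\<And>f. f \<in> H \<Longrightarrow> 0 \<le> ip f f"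
    and ip_definite: "\<And>f. f \<in> H \<Longrightarrow> ip f f = 0 \<Longrightarrow> f = (\<lambda>x. 0)"
    and complete: "\<And>s :: nat \<Rightarrow> 'a \<Rightarrow> real. (\<And>n. s n \<in> H) \<Longrightarrow>
           (\<forall>e>0. \<exists>N. \<forall>m\<ge>N. \<forall>n\<ge>N.
              sqrt (ip (\<lambda>x. s m x - s n x) (\<lambda>x. s m x - s n x)) < e) \<Longrightarrow>
           (\<exists>f\<in>H. (\<lambda>n. sqrt (ip (\<lambda>x. s n x - f x) (\<lambda>x. s n x - f x))) \<longlonglongrightarrow> 0)"
    and kernel_mem: "\<And>x. k x \<in> H"
    and reproducing: "\<And>f x. f \<in> H \<Longrightarrow> ip f (k x) = f x"

definition ip_norm :: "(('a \<Rightarrow> real) \<Rightarrow> ('a \<Rightarrow> real) \<Rightarrow> real) \<Rightarrow> ('a \<Rightarrow> real) \<Rightarrow> real" where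
  "ip_norm ip f = sqrt (ip f f)"

text \<open>
  Density of \<open>H\<close> in \<open>C(X)\<close>. It is only used when the whole type is compact; then the Banach
  space of bounded continuous functions is \<open>C(X)\<close> with the supremum norm.
\<close>

definition dense_in_continuous :: "('a::topological_space \<Rightarrow> real) set \<Rightarrow> bool" where
  "dense_in_continuous H \<longleftrightarrow>
     (\<forall>f\<in>H. continuous_on UNIV f) \<and>
     closure {g :: 'a \<Rightarrow>\<^sub>C real. apply_bcontfun g \<in> H} = UNIV"

definition gibbs_kernel :: "real \<Rightarrow> ('a \<Rightarrow> 'a \<Rightarrow> real) \<Rightarrow> 'a \<Rightarrow> 'a \<Rightarrow> real" where
  "gibbs_kernel \<epsilon> c x y = exp (- c x y / \<epsilon>)"

definition sup_norm :: "('a \<Rightarrow> 'a \<Rightarrow> real) \<Rightarrow> real" where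
  "sup_norm c = (SUP (x, y)\<in>UNIV. \<bar>c x y\<bar>)"


section \<open>The self-transport potential and the operator \<open>K\<^sub>\<mu>\<close>\<close>

definition self_potential ::
    "real \<Rightarrow> ('a::topological_space \<Rightarrow> 'a \<Rightarrow> real) \<Rightarrow> 'a measure \<Rightarrow> 'a \<Rightarrow> real" where
  "self_potential \<epsilon> c \<mu> = (THE f. continuous_on UNIV f \<and>
     (\<forall>y. (\<integral>x. exp (1 / \<epsilon> * (f x + f y - c x y)) \<partial>\<mu>) = 1))"

definition scaling ::
    "real \<Rightarrow> ('a::topological_space \<Rightarrow> 'a \<Rightarrow> real) \<Rightarrow> 'a measure \<Rightarrow> 'a \<Rightarrow> real" where
  "scaling \<epsilon> c \<mu> x = exp (self_potential \<epsilon> c \<mu> x / \<epsilon>)"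

definition B_embed ::
    "real \<Rightarrow> ('a::topological_space \<Rightarrow> 'a \<Rightarrow> real) \<Rightarrow> 'a measure \<Rightarrow> 'a \<Rightarrow> real" where
  "B_embed \<epsilon> c \<mu> = (\<lambda>y. \<integral>x. scaling \<epsilon> c \<mu> x * gibbs_kernel \<epsilon> c x y \<partial>\<mu>)"

definition k_mu ::
    "real \<Rightarrow> ('a::topological_space \<Rightarrow> 'a \<Rightarrow> real) \<Rightarrow> 'a measure \<Rightarrow> 'a \<Rightarrow> 'a \<Rightarrow> real" where
  "k_mu \<epsilon> c \<mu> x y = scaling \<epsilon> c \<mu> x * scaling \<epsilon> c \<mu> y * gibbs_kernel \<epsilon> c x y"

definition K_mu ::
    "real \<Rightarrow> ('a::topological_space \<Rightarrow> 'a \<Rightarrow> real) \<Rightarrow> 'a measure \<Rightarrow> ('a \<Rightarrow> real) \<Rightarrow> 'a \<Rightarrow> real" where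
  "K_mu \<epsilon> c \<mu> \<phi> = (\<lambda>y. \<integral>x. \<phi> x * k_mu \<epsilon> c \<mu> x y \<partial>\<mu>)"


section \<open>The quotient of \<open>L\<^sup>2\<close> by constants\<close>

definition L2 :: "'a measure \<Rightarrow> ('a \<Rightarrow> real) set" where
  "L2 \<mu> = {\<phi> \<in> borel_measurable \<mu>. integrable \<mu> (\<lambda>x. (\<phi> x)\<^sup>2)}"

text \<open>
  Functions (not almost-everywhere classes) are the elements of \<open>L2 \<mu>\<close>, so this relation
  identifies functions both almost everywhere and up to additive constants.
\<close>

definition eq_mod_const :: "'a measure \<Rightarrow> (('a \<Rightarrow> real) \<times> ('a \<Rightarrow> real)) set" where
  "eq_mod_const \<mu> = {(\<phi>, \<psi>). \<phi> \<in> L2 \<mu> \<and> \<psi> \<in> L2 \<mu> \<and> (\<exists>r. AE x in \<mu>. \<phi> x = \<psi> x + r)}"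

definition L2_mod_const :: "'a measure \<Rightarrow> ('a \<Rightarrow> real) set set" where
  "L2_mod_const \<mu> = L2 \<mu> // eq_mod_const \<mu>"

definition id_minus_K ::
    "real \<Rightarrow> ('a::topological_space \<Rightarrow> 'a \<Rightarrow> real) \<Rightarrow> 'a measure
       \<Rightarrow> ('a \<Rightarrow> real) set \<Rightarrow> ('a \<Rightarrow> real) set" where
  "id_minus_K \<epsilon> c \<mu> U = (\<Union>\<phi>\<in>U. eq_mod_const \<mu> `` {\<lambda>x. \<phi> x - K_mu \<epsilon> c \<mu> \<phi> x})"

definition id_minus_K_inverse ::
    "real \<Rightarrow> ('a::topological_space \<Rightarrow> 'a \<Rightarrow> real) \<Rightarrow> 'a measure
       \<Rightarrow> ('a \<Rightarrow> real) set \<Rightarrow> ('a \<Rightarrow> real) set" where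
  "id_minus_K_inverse \<epsilon> c \<mu> = the_inv_into (L2_mod_const \<mu>) (id_minus_K \<epsilon> c \<mu>)"

text \<open>
  The pairing of a function of zero mean with a class modulo constants: the common value of
  the \<open>L\<^sup>2\<close> inner products with all representatives.
\<close>

definition L2_pairing :: "'a measure \<Rightarrow> ('a \<Rightarrow> real) \<Rightarrow> ('a \<Rightarrow> real) set \<Rightarrow> real" where
  "L2_pairing \<mu> \<phi> U = the_elem ((\<lambda>\<psi>. \<integral>x. \<phi> x * \<psi> x \<partial>\<mu>) ` U)"

text \<open>The quadratic form \<open>\<beta> \<mapsto> g\<^sub>\<mu>(\<beta>, \<beta>)\<close>; \<open>ip\<close> is the inner product of the RKHS of the Gibbs kernel.\<close>

definition metric_tensor ::
    "real \<Rightarrow> ('a::topological_space \<Rightarrow> 'a \<Rightarrow> real)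
       \<Rightarrow> (('a \<Rightarrow> real) \<Rightarrow> ('a \<Rightarrow> real) \<Rightarrow> real) \<Rightarrow> 'a measure \<Rightarrow> ('a \<Rightarrow> real) \<Rightarrow> real" where
  "metric_tensor \<epsilon> c ip \<mu> \<beta> =
     (let \<phi> = (\<lambda>x. scaling \<epsilon> c \<mu> x * \<beta> x) in
      \<epsilon> / 2 * ((ip_norm ip \<beta>)\<^sup>2
        + 2 * L2_pairing \<mu> \<phi> (id_minus_K_inverse \<epsilon> c \<mu> (eq_mod_const \<mu> `` {\<phi>}))))"

end

theory Submission
  imports Defs
begin

text \<open>
  Put \<open>l = exp (- \<parallel>c\<parallel> / \<epsilon>) \<le> k\<^sub>c \<le> 1\<close>. Integrating the equation of the scaling \<open>a\<close> gives \<open>a \<le> 1 / l\<close> and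
  \<open>k\<^sub>\<mu> \<ge> l\<^sup>2\<close>, so \<open>K\<^sub>\<mu>\<close> is a symmetric Markov operator satisfying a Doeblin condition: it contracts
  continuous functions of mean zero by the factor \<open>1 - l\<^sup>2\<close> in the supremum norm. For
  \<open>\<phi> = a \<beta>\<close>, of mean zero by the assumption on \<open>\<beta>\<close>, the Neumann series therefore
  gives a continuous \<open>\<psi>\<close> with \<open>\<psi> - K\<^sub>\<mu> \<psi> = \<phi>\<close> and \<open>|\<psi>| \<le> sup |\<phi>| / l\<^sup>2\<close>. As \<open>K\<^sub>\<mu>\<close> is symmetric and Markov,
  \<open>\<langle>\<phi>, \<psi>\<rangle> = \<langle>\<psi> - K\<^sub>\<mu> \<psi>, \<psi>\<rangle> \<ge> 0\<close>, which is the lower bound. Moreover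
  \<open>|\<beta>| \<le> \<parallel>\<beta>\<parallel>\<close> by the reproducing property, whence \<open>\<langle>\<phi>, \<psi>\<rangle> \<le> \<parallel>\<beta>\<parallel>\<^sup>2 / l\<^sup>4\<close>; this is the upper bound
  with the better exponent \<open>4 \<parallel>c\<parallel> / \<epsilon>\<close>.
\<close>

section \<open>Integration on a compact metric space\<close>

text \<open>The type \<open>'a\<close> itself plays the role of the compact space. Every Borel
  probability measure on a compact metric space is Radon, so the locale describes exactly the
  elements of P(X).\<close>

locale compact_prob_space = prob_space \<mu> for \<mu> :: "'a::metric_space measure" +
  assumes compact_UNIV: "compact (UNIV :: 'a set)"
    and sets_borel: "sets \<mu> = sets borel"
begin

lemma space_UNIV: "space \<mu> = UNIV"
  using sets_eq_imp_space_eq[OF sets_borel] by simp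

lemma continuous_measurable: "continuous_on UNIV f \<Longrightarrow> f \<in> borel_measurable \<mu>"
  by (subst measurable_cong_sets[OF sets_borel refl]) (rule borel_measurable_continuous_onI)

lemma continuous_bounded:
  fixes f :: "'a \<Rightarrow> real"
  assumes "continuous_on UNIV f"
  obtains B where "0 \<le> B" "\<And>x. \<bar>f x\<bar> \<le> B"
proof -
  have "bounded (range f)"
    using compact_continuous_image[OF assms compact_UNIV] by (rule compact_imp_bounded)
  then obtain B where "\<And>x. \<bar>f x\<bar> \<le> B" by (auto simp: bounded_iff)
  moreover from this[of undefined] have "0 \<le> B" by linarith
  ultimately show ?thesis using that by blast
qed

lemma continuous_integrable:
  fixes f :: "'a \<Rightarrow> real"
  assumes "continuous_on UNIV f"
  shows "integrable \<mu> f"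
proof -
  obtain B where "\<And>x. \<bar>f x\<bar> \<le> B" using continuous_bounded[OF assms] by blast
  then show ?thesis
    by (intro integrable_const_bound[where B = B] continuous_measurable assms) auto
qed

lemma kernel_bounded:
  fixes k :: "'a \<Rightarrow> 'a \<Rightarrow> real"
  assumes "continuous_on UNIV (\<lambda>(x, y). k x y)"
  obtains B where "0 \<le> B" "\<And>x y. \<bar>k x y\<bar> \<le> B"
proof -
  have "compact (UNIV :: ('a \<times> 'a) set)"
    using compact_Times[OF compact_UNIV compact_UNIV] by simp
  then have "bounded (range (\<lambda>(x, y). k x y))"
    using compact_continuous_image[OF assms] compact_imp_bounded by blast
  then obtain B where B: "\<And>p. \<bar>(\<lambda>(x, y). k x y) p\<bar> \<le> B" by (auto simp: bounded_iff)
  then have "\<bar>k x y\<bar> \<le> B" for x y using B[of "(x, y)"] by simp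
  moreover from this[of undefined undefined] have "0 \<le> B" by linarith
  ultimately show ?thesis using that by blast
qed

lemma kernel_continuous_left:
  fixes k :: "'a \<Rightarrow> 'a \<Rightarrow> real"
  assumes "continuous_on UNIV (\<lambda>(x, y). k x y)"
  shows "continuous_on UNIV (\<lambda>x. k x y)"
  using continuous_on_compose2[OF assms, of UNIV "\<lambda>x. (x, y)"]
  by (simp add: continuous_intros)

lemma kernel_continuous_right:
  fixes k :: "'a \<Rightarrow> 'a \<Rightarrow> real"
  assumes "continuous_on UNIV (\<lambda>(x, y). k x y)"
  shows "continuous_on UNIV (\<lambda>y. k x y)"
  using continuous_on_compose2[OF assms, of UNIV "\<lambda>y. (x, y)"]
  by (simp add: continuous_intros)

lemma integrable_mult_continuous:
  fixes w f :: "'a \<Rightarrow> real"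
  assumes w: "integrable \<mu> w" and f: "continuous_on UNIV f"
  shows "integrable \<mu> (\<lambda>x. w x * f x)"
proof -
  obtain B where B: "\<And>x. \<bar>f x\<bar> \<le> B" using continuous_bounded[OF f] by blast
  show ?thesis
  proof (rule Bochner_Integration.integrable_bound)
    show "integrable \<mu> (\<lambda>x. B * \<bar>w x\<bar>)" using w by simp
    show "(\<lambda>x. w x * f x) \<in> borel_measurable \<mu>"
      using w continuous_measurable[OF f] by measurable
    show "AE x in \<mu>. norm (w x * f x) \<le> norm (B * \<bar>w x\<bar>)"
    proof (rule AE_I2)
      fix x
      have "\<bar>f x\<bar> * \<bar>w x\<bar> \<le> \<bar>B\<bar> * \<bar>w x\<bar>"
        using B[of x] by (intro mult_right_mono) auto
      then show "norm (w x * f x) \<le> norm (B * \<bar>w x\<bar>)" by (simp add: abs_mult mult.commute)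
    qed
  qed
qed

text \<open>Dominated convergence along sequences, with majorant \<open>B * \<bar>w x\<bar>\<close>.
  Integrability of \<open>w\<close> suffices, so a continuous kernel turns any \<open>L2\<close>
  function into a continuous one; uniqueness modulo constants relies on this smoothing.\<close>

lemma continuous_kernel_integral:
  fixes k :: "'a \<Rightarrow> 'a \<Rightarrow> real"
  assumes w: "integrable \<mu> w" and k: "continuous_on UNIV (\<lambda>(x, y). k x y)"
  shows "continuous_on UNIV (\<lambda>y. \<integral>x. w x * k x y \<partial>\<mu>)"
proof -
  obtain B where B: "\<And>x y. \<bar>k x y\<bar> \<le> B" using kernel_bounded[OF k] by blast
  show ?thesis
  proof (subst continuous_on_sequentially, intro allI ballI impI, elim conjE)
    fix s :: "nat \<Rightarrow> 'a" and y :: 'a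
    assume s: "s \<longlonglongrightarrow> y"
    show "((\<lambda>y. \<integral>x. w x * k x y \<partial>\<mu>) \<circ> s) \<longlonglongrightarrow> (\<integral>x. w x * k x y \<partial>\<mu>)"
      unfolding o_def
    proof (rule integral_dominated_convergence[where w = "\<lambda>x. B * \<bar>w x\<bar>"])
      show "(\<lambda>x. w x * k x y) \<in> borel_measurable \<mu>"
        using integrable_mult_continuous[OF w kernel_continuous_left[OF k]] by blast
      show "(\<lambda>x. w x * k x (s i)) \<in> borel_measurable \<mu>" for i
        using integrable_mult_continuous[OF w kernel_continuous_left[OF k]] by blast
      show "integrable \<mu> (\<lambda>x. B * \<bar>w x\<bar>)" using w by simp
      have "(\<lambda>i. k x (s i)) \<longlonglongrightarrow> k x y" for x
        using continuous_on_tendsto_compose[OF kernel_continuous_right[OF k] s] by simp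
      then show "AE x in \<mu>. (\<lambda>i. w x * k x (s i)) \<longlonglongrightarrow> w x * k x y"
        by (intro AE_I2 tendsto_mult tendsto_const)
      show "AE x in \<mu>. norm (w x * k x (s i)) \<le> B * \<bar>w x\<bar>" for i
        using B by (intro AE_I2) (simp add: abs_mult mult.commute[of B] mult_left_mono)
    qed
  qed
qed

section \<open>Finitely valued approximations of the identity, and Fubini\<close>

lemma quantisation:
  assumes e: "0 < e"
  obtains g :: "'a \<Rightarrow> 'a"
  where "finite (range g)" "\<And>z. g -` {z} \<in> sets \<mu>" "\<And>x. dist (g x) x < e"
proof -
  obtain T :: "'a set" where T: "finite T" "UNIV \<subseteq> (\<Union>z\<in>T. ball z e)"
    using compact_UNIV e unfolding compact_eq_totally_bounded by blast
  \<comment> \<open>Induction over the centres of a finite cover. The distance bound is claimed only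
    on the balls treated so far, so an arbitrary constant map serves for the empty cover.\<close>
  have "\<exists>g::'a \<Rightarrow> 'a. finite (range g) \<and> (\<forall>z. g -` {z} \<in> sets borel) \<and>
          (\<forall>x\<in>(\<Union>z\<in>T. ball z e). dist (g x) x < e)"
    using T(1)
  proof induction
    case empty
    show ?case by (intro exI[of _ "\<lambda>_. undefined"]) (auto simp: vimage_const)
  next
    case (insert t T)
    then obtain g where g: "finite (range g)" "\<And>z. g -` {z} \<in> sets borel"
      "\<And>x. x \<in> (\<Union>z\<in>T. ball z e) \<Longrightarrow> dist (g x) x < e" by blast
    define h where "h = (\<lambda>x. if x \<in> ball t e then t else g x)"
    have "range h \<subseteq> insert t (range g)" by (auto simp: h_def)
    then have 1: "finite (range h)" using g(1) finite_subset by blast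
    \<comment> \<open>The newest ball takes priority: its points leave their earlier fibres and join
      that of \<open>t\<close>, which keeps all fibres Borel.\<close>
    have "h -` {z} = (if z = t then ball t e else {}) \<union> (g -` {z} - ball t e)" for z
      by (auto simp: h_def)
    then have 2: "h -` {z} \<in> sets borel" for z using g(2) by auto
    have 3: "dist (h x) x < e" if "x \<in> (\<Union>z\<in>insert t T. ball z e)" for x
      using g(3)[of x] that by (auto simp: h_def)
    show ?case using 1 2 3 by blast
  qed
  then obtain g :: "'a \<Rightarrow> 'a" where g: "finite (range g)" "\<And>z. g -` {z} \<in> sets borel"
      "\<And>x. x \<in> (\<Union>z\<in>T. ball z e) \<Longrightarrow> dist (g x) x < e" by blast
  show ?thesis using that[of g] g T(2) sets_borel by blast
qed

lemma quantisation_measurable: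
  assumes "finite (range g)" "\<And>z. g -` {z} \<in> sets \<mu>"
  shows "g \<in> measurable \<mu> (count_space (range g))"
  using assms by (auto simp: measurable_count_space_eq2 space_UNIV)

lemma quantisation_sequence:
  obtains g :: "nat \<Rightarrow> 'a \<Rightarrow> 'a"
  where "\<And>n. finite (range (g n))" "\<And>n z. g n -` {z} \<in> sets \<mu>"
    "\<And>n x. dist (g n x) x < 1 / real (Suc n)" "\<And>x. (\<lambda>n. g n x) \<longlonglongrightarrow> x"
proof -
  have "\<exists>g :: 'a \<Rightarrow> 'a. finite (range g) \<and> (\<forall>z. g -` {z} \<in> sets \<mu>) \<and>
      (\<forall>x. dist (g x) x < 1 / real (Suc n))" for n
    using quantisation[of "1 / real (Suc n)"] by (metis of_nat_0_less_iff zero_less_Suc zero_less_divide_1_iff)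
  then obtain g :: "nat \<Rightarrow> 'a \<Rightarrow> 'a" where g: "\<And>n. finite (range (g n))"
    "\<And>n z. g n -` {z} \<in> sets \<mu>" "\<And>n x. dist (g n x) x < 1 / real (Suc n)" by metis
  have "(\<lambda>n. g n x) \<longlonglongrightarrow> x" for x
  proof (rule metric_LIMSEQ_I)
    fix r :: real assume "0 < r"
    then obtain N where N: "1 / real (Suc N) < r" using nat_approx_posE by blast
    have "dist (g n x) x < r" if "n \<ge> N" for n
    proof -
      have "1 / real (Suc n) \<le> 1 / real (Suc N)" using that by (intro divide_left_mono) auto
      then show ?thesis using g(3)[of n x] N by linarith
    qed
    then show "\<exists>no. \<forall>n\<ge>no. dist (g n x) x < r" by blast
  qed
  with g show ?thesis using that by blast
qed

text \<open>
  The compact space is second countable, but its type is not an instance of the class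
  \<open>second_countable_topology\<close> that \<open>borel_prod\<close> needs. Measurability for the product
  \<open>\<sigma>\<close>-algebra is obtained from finitely valued approximations of the identity instead.
\<close>

lemma kernel_measurable:
  fixes k :: "'a \<Rightarrow> 'a \<Rightarrow> real"
  assumes k: "continuous_on UNIV (\<lambda>(x, y). k x y)"
  shows "(\<lambda>(x, y). k x y) \<in> borel_measurable (\<mu> \<Otimes>\<^sub>M \<mu>)"
proof -
  obtain g :: "nat \<Rightarrow> 'a \<Rightarrow> 'a" where g: "\<And>n. finite (range (g n))"
    "\<And>n z. g n -` {z} \<in> sets \<mu>" "\<And>x. (\<lambda>n. g n x) \<longlonglongrightarrow> x"
    using quantisation_sequence by metis
  \<comment> \<open>Only the first variable is approximated: for each of its finitely many values,
    the function depends on the second variable alone.\<close>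
  have "(\<lambda>p. k (fst p) (snd p)) \<in> borel_measurable (\<mu> \<Otimes>\<^sub>M \<mu>)"
  proof (rule borel_measurable_LIMSEQ_real)
    show "(\<lambda>i. k (g i (fst p)) (snd p)) \<longlonglongrightarrow> k (fst p) (snd p)" for p
      using continuous_on_tendsto_compose[OF kernel_continuous_left[OF k] g(3)] by simp
    fix i
    have gm: "g i \<in> measurable \<mu> (count_space (range (g i)))"
      using quantisation_measurable g by blast
    have km: "k z \<in> borel_measurable \<mu>" for z
      by (intro continuous_measurable kernel_continuous_right k)
    show "(\<lambda>p. k (g i (fst p)) (snd p)) \<in> borel_measurable (\<mu> \<Otimes>\<^sub>M \<mu>)"
    proof (rule measurable_compose_countable'[where I = "range (g i)" and g = "\<lambda>p. g i (fst p)"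
          and f = "\<lambda>z p. k z (snd p)"])
      show "(\<lambda>p. k z (snd p)) \<in> borel_measurable (\<mu> \<Otimes>\<^sub>M \<mu>)" for z
        by (rule measurable_compose[OF measurable_snd km])
      show "(\<lambda>p. g i (fst p)) \<in> \<mu> \<Otimes>\<^sub>M \<mu> \<rightarrow>\<^sub>M count_space (range (g i))"
        by (rule measurable_compose[OF measurable_fst gm])
      show "countable (range (g i))" using g(1) countable_finite by blast
    qed
  qed
  then show ?thesis by (simp add: case_prod_beta')
qed

lemma Fubini_kernel:
  fixes k :: "'a \<Rightarrow> 'a \<Rightarrow> real"
  assumes k: "continuous_on UNIV (\<lambda>(x, y). k x y)"
  shows "(\<integral>y. (\<integral>x. k x y \<partial>\<mu>) \<partial>\<mu>) = (\<integral>x. (\<integral>y. k x y \<partial>\<mu>) \<partial>\<mu>)"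
proof -
  interpret P: pair_prob_space \<mu> \<mu> ..
  obtain B where "\<And>x y. \<bar>k x y\<bar> \<le> B" using kernel_bounded[OF k] by blast
  then have "integrable (\<mu> \<Otimes>\<^sub>M \<mu>) (\<lambda>(x, y). k x y)"
    by (intro P.P.integrable_const_bound[where B = B] kernel_measurable k) auto
  then show ?thesis by (rule P.Fubini_integral)
qed

text \<open>\<open>F\<close> may be arbitrary, since its composition with \<open>g\<close> is a
  finite combination of indicators of measurable fibres. This produces the Riemann sums to which
  \<open>finite_combination\<close> applies.\<close>

lemma integral_quantised:
  fixes F :: "'a \<Rightarrow> real"
  assumes "finite (range g)" "\<And>z. g -` {z} \<in> sets \<mu>"
  shows "(\<integral>x. F (g x) \<partial>\<mu>) = (\<Sum>z\<in>range g. F z * measure \<mu> (g -` {z}))"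
    and "integrable \<mu> (\<lambda>x. F (g x))"
proof -
  have eq: "F (g x) = (\<Sum>z\<in>range g. F z * indicator (g -` {z}) x)" for x
    using assms(1) by (subst sum.remove[of _ "g x"]) (auto intro!: sum.neutral split: split_indicator)
  show "integrable \<mu> (\<lambda>x. F (g x))"
    unfolding eq using assms(2) by (intro Bochner_Integration.integrable_sum) (auto simp: emeasure_eq_measure)
  show "(\<integral>x. F (g x) \<partial>\<mu>) = (\<Sum>z\<in>range g. F z * measure \<mu> (g -` {z}))"
    unfolding eq using assms(2)
    by (subst Bochner_Integration.integral_sum) (auto simp: emeasure_eq_measure space_UNIV)
qed

end


section \<open>Existence and uniqueness of the scaling\<close>

context compact_prob_space
begin

text \<open>A Sinkhorn step in logarithmic form: the logarithm of the scaling is exactly a fixed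
  point. Adding a constant to \<open>f\<close> subtracts it from the result.\<close>

definition log_op :: "('a \<Rightarrow> 'a \<Rightarrow> real) \<Rightarrow> ('a \<Rightarrow> real) \<Rightarrow> 'a \<Rightarrow> real" where
  "log_op k f y = - ln (\<integral>x. exp (f x) * k x y \<partial>\<mu>)"

lemma integral_exp_kernel_bounds:
  fixes k :: "'a \<Rightarrow> 'a \<Rightarrow> real"
  assumes k: "continuous_on UNIV (\<lambda>(x, y). k x y)" and l: "0 < l" "\<And>x y. l \<le> k x y" "\<And>x y. k x y \<le> 1"
    and f: "continuous_on UNIV f"
  shows "0 < (\<integral>x. exp (f x) \<partial>\<mu>)"
    and "l * (\<integral>x. exp (f x) \<partial>\<mu>) \<le> (\<integral>x. exp (f x) * k x y \<partial>\<mu>)"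
    and "(\<integral>x. exp (f x) * k x y \<partial>\<mu>) \<le> (\<integral>x. exp (f x) \<partial>\<mu>)"
    and "0 < (\<integral>x. exp (f x) * k x y \<partial>\<mu>)"
proof -
  have cf: "continuous_on UNIV (\<lambda>x. exp (f x))" using f by (intro continuous_intros)
  have ck: "continuous_on UNIV (\<lambda>x. exp (f x) * k x y)"
    by (intro continuous_on_mult cf kernel_continuous_left k)
  obtain B where B: "\<And>x. \<bar>f x\<bar> \<le> B" using continuous_bounded[OF f] by blast
  have "exp (- B) = (\<integral>x. exp (- B) \<partial>\<mu>)" by (simp add: prob_space)
  also have "\<dots> \<le> (\<integral>x. exp (f x) \<partial>\<mu>)"
    using abs_le_D2[OF B] by (intro integral_mono continuous_integrable cf) (auto simp: minus_le_iff)
  finally show G: "0 < (\<integral>x. exp (f x) \<partial>\<mu>)" by (rule less_le_trans[OF exp_gt_zero])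
  have "l * (\<integral>x. exp (f x) \<partial>\<mu>) = (\<integral>x. exp (f x) * l \<partial>\<mu>)" by (simp add: mult.commute)
  also have "\<dots> \<le> (\<integral>x. exp (f x) * k x y \<partial>\<mu>)"
    by (intro integral_mono continuous_integrable ck continuous_on_mult cf continuous_on_const
        mult_left_mono l) auto
  finally show L: "l * (\<integral>x. exp (f x) \<partial>\<mu>) \<le> (\<integral>x. exp (f x) * k x y \<partial>\<mu>)" .
  show "(\<integral>x. exp (f x) * k x y \<partial>\<mu>) \<le> (\<integral>x. exp (f x) \<partial>\<mu>)"
    using l(3) by (intro integral_mono continuous_integrable ck cf) (simp add: mult_left_le)
  show "0 < (\<integral>x. exp (f x) * k x y \<partial>\<mu>)"
    using L G l(1) by (meson less_le_trans mult_pos_pos)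
qed

lemma continuous_log_op:
  fixes k :: "'a \<Rightarrow> 'a \<Rightarrow> real"
  assumes k: "continuous_on UNIV (\<lambda>(x, y). k x y)" and l: "0 < l" "\<And>x y. l \<le> k x y" "\<And>x y. k x y \<le> 1"
    and f: "continuous_on UNIV f"
  shows "continuous_on UNIV (log_op k f)"
proof -
  have "continuous_on UNIV (\<lambda>x. exp (f x))" using f by (intro continuous_intros)
  then have "continuous_on UNIV (\<lambda>y. \<integral>x. exp (f x) * k x y \<partial>\<mu>)"
    by (intro continuous_kernel_integral continuous_integrable k)
  moreover have "(\<integral>x. exp (f x) * k x y \<partial>\<mu>) \<noteq> 0" for y
    using integral_exp_kernel_bounds(4)[OF assms, of y] by simp
  ultimately show ?thesis
    unfolding log_op_def by (intro continuous_intros) auto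
qed

text \<open>Source of the contraction factor. Factor out \<open>exp w\<close>, use
  \<open>ln t \<le> t - 1\<close>, and bound \<open>1 - exp (- w)\<close> below by
  \<open>w / (1 + w)\<close>; the bound \<open>R\<close> on \<open>w\<close> makes the gain
  proportional to \<open>w\<close> with a fixed constant.\<close>

lemma log_mixture_le:
  fixes l w R :: real
  assumes "0 < l" "l \<le> 1" "0 \<le> w" "w \<le> R"
  shows "ln (l + (1 - l) * exp w) \<le> (1 - l / (1 + R)) * w"
proof -
  have pos: "0 < 1 - l * (1 - exp (- w))"
  proof -
    have "l * (1 - exp (- w)) \<le> 1 * (1 - exp (- w))" using assms by (intro mult_right_mono) auto
    then show ?thesis by (smt (verit) exp_gt_zero)
  qed
  have "l + (1 - l) * exp w = exp w * (1 - l * (1 - exp (- w)))"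
    by (simp add: algebra_simps exp_minus)
  then have "ln (l + (1 - l) * exp w) = w + ln (1 - l * (1 - exp (- w)))"
    using pos by (simp add: ln_mult)
  also have "\<dots> \<le> w - l * (1 - exp (- w))"
    using ln_le_minus_one[OF pos] by simp
  also have "\<dots> \<le> w - l * (w / (1 + R))"
  proof -
    have "exp (- w) \<le> 1 / (1 + w)"
      using exp_ge_add_one_self[of w] assms(3) by (simp add: exp_minus field_simps)
    then have "w / (1 + w) \<le> 1 - exp (- w)" using assms(3) by (simp add: field_simps)
    moreover have "w / (1 + R) \<le> w / (1 + w)" using assms by (intro divide_left_mono) auto
    ultimately have "l * (w / (1 + R)) \<le> l * (1 - exp (- w))"
      using assms(1) by (intro mult_left_mono) auto
    then show ?thesis by linarith
  qed
  finally show ?thesis by (simp add: algebra_simps)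
qed

text \<open>
  The measures \<open>exp g * k _ y\<close>, normalised, all dominate \<open>l\<close> times the normalised \<open>exp g\<close>.
  Hence the oscillation of \<open>log_op k f - log_op k g\<close> is strictly smaller than that of \<open>f - g\<close>,
  uniformly as long as the latter is at most \<open>R\<close>.
\<close>

lemma log_op_contraction:
  fixes k :: "'a \<Rightarrow> 'a \<Rightarrow> real"
  assumes k: "continuous_on UNIV (\<lambda>(x, y). k x y)" and l: "0 < l" "\<And>x y. l \<le> k x y" "\<And>x y. k x y \<le> 1"
    and f: "continuous_on UNIV f" and g: "continuous_on UNIV g"
    and fg: "\<And>x. m \<le> f x - g x" "\<And>x. f x - g x \<le> m + w" and w: "0 \<le> w" "w \<le> R"
  obtains m' where "\<And>y. m' \<le> log_op k f y - log_op k g y"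
    "\<And>y. log_op k f y - log_op k g y \<le> m' + (1 - l / (1 + R)) * w"
proof -
  have l1: "l \<le> 1" using l(2,3) order_trans by blast
  define F where "F = (\<integral>x. exp (f x) \<partial>\<mu>)"
  define G where "G = (\<integral>x. exp (g x) \<partial>\<mu>)"
  define p where "p y = (\<integral>x. exp (f x) * k x y \<partial>\<mu>)" for y
  define q where "q y = (\<integral>x. exp (g x) * k x y \<partial>\<mu>)" for y
  note bf = integral_exp_kernel_bounds[OF k l f, folded F_def p_def]
  note bg = integral_exp_kernel_bounds[OF k l g, folded G_def q_def]
  note F0 = bf(1) and G0 = bg(1)
  have cf: "continuous_on UNIV (\<lambda>x. exp (f x))" and cg: "continuous_on UNIV (\<lambda>x. exp (g x))"
    using f g by (intro continuous_intros; simp)+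
  have ck: "continuous_on UNIV (\<lambda>x. k x y)" for y by (rule kernel_continuous_left[OF k])
  have le1: "exp m * exp (g x) \<le> exp (f x)" for x
    using fg(1)[of x] by (simp flip: exp_add)
  have le2: "exp (f x) \<le> exp (m + w) * exp (g x)" for x
    using fg(2)[of x] by (simp flip: exp_add)
  have A: "exp m \<le> F / G"
  proof -
    have "exp m * G = (\<integral>x. exp m * exp (g x) \<partial>\<mu>)" by (simp add: G_def)
    also have "\<dots> \<le> F" unfolding F_def
      by (intro integral_mono continuous_integrable continuous_on_mult continuous_on_const cf cg le1)
    finally show ?thesis using G0 by (simp add: field_simps)
  qed
  \<comment> \<open>\<open>s\<close> is the kernel minus the part \<open>l * q y / G\<close>, which
    does not depend on \<open>x\<close>; it stays nonnegative because \<open>q y \<le> G\<close>.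
    The removed part contributes in proportion to \<open>F\<close> and \<open>G\<close> at every
    \<open>y\<close>, so only the rest sees the variation of \<open>f - g\<close>.\<close>
  define s where "s = (\<lambda>x y. k x y - l * q y / G)"
  have s0: "0 \<le> s x y" for x y
  proof -
    have "q y / G \<le> 1" using bg(3)[of y] G0 by simp
    then have "l * (q y / G) \<le> l * 1" using l(1) by (intro mult_left_mono) auto
    then show ?thesis using l(2)[of x y] by (simp add: s_def)
  qed
  have cs: "continuous_on UNIV (\<lambda>x. s x y)" for y
    unfolding s_def by (intro continuous_intros ck)
  have ps: "p y = l * F * q y / G + (\<integral>x. exp (f x) * s x y \<partial>\<mu>)" for y
  proof -
    have "(\<integral>x. exp (f x) * s x y \<partial>\<mu>) = (\<integral>x. exp (f x) * k x y - exp (f x) * (l * q y / G) \<partial>\<mu>)"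
      by (simp add: s_def algebra_simps)
    also have "\<dots> = p y - F * (l * q y / G)"
      unfolding p_def F_def
      by (subst Bochner_Integration.integral_diff)
        (auto intro!: continuous_integrable continuous_on_mult continuous_on_const cf ck
          simp del: times_divide_eq_right)
    finally show ?thesis by simp
  qed
  have qs: "(\<integral>x. exp (g x) * s x y \<partial>\<mu>) = (1 - l) * q y" for y
  proof -
    have "(\<integral>x. exp (g x) * s x y \<partial>\<mu>) = (\<integral>x. exp (g x) * k x y - exp (g x) * (l * q y / G) \<partial>\<mu>)"
      by (simp add: s_def algebra_simps)
    also have "\<dots> = q y - G * (l * q y / G)"
      unfolding q_def G_def
      by (subst Bochner_Integration.integral_diff)
        (auto intro!: continuous_integrable continuous_on_mult continuous_on_const cg ck
          simp del: times_divide_eq_right)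
    finally show ?thesis using G0 by (simp add: algebra_simps)
  qed
  \<comment> \<open>\<open>U\<close> and \<open>V\<close> bound \<open>p y / q y\<close> from above
    and below: on the removed part the ratio is \<open>F / G\<close>, and on the rest
    \<open>exp (f x - g x)\<close> is replaced by its extreme values \<open>exp (m + w)\<close> and
    \<open>exp m\<close>.\<close>
  define U where "U = l * (F / G) + (1 - l) * exp (m + w)"
  define V where "V = l * (F / G) + (1 - l) * exp m"
  have FG: "0 < F / G" using F0 G0 by simp
  have U0: "0 < U" and V0: "0 < V" unfolding U_def V_def using l1
    by (auto intro!: add_pos_nonneg mult_pos_pos[OF l(1) FG] simp del: times_divide_eq_right)
  have up: "p y \<le> U * q y" for y
  proof -
    have "(\<integral>x. exp (f x) * s x y \<partial>\<mu>) \<le> (\<integral>x. exp (m + w) * (exp (g x) * s x y) \<partial>\<mu>)"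
      using mult_right_mono[OF le2 s0]
      by (intro integral_mono continuous_integrable continuous_on_mult continuous_on_const cf cg cs)
        (simp add: mult.assoc)
    also have "\<dots> = exp (m + w) * ((1 - l) * q y)" by (simp add: qs)
    finally show ?thesis unfolding ps[of y] U_def by (simp add: algebra_simps)
  qed
  have lo: "V * q y \<le> p y" for y
  proof -
    have "exp m * ((1 - l) * q y) = (\<integral>x. exp m * (exp (g x) * s x y) \<partial>\<mu>)" by (simp add: qs)
    also have "\<dots> \<le> (\<integral>x. exp (f x) * s x y \<partial>\<mu>)"
      using mult_right_mono[OF le1 s0]
      by (intro integral_mono continuous_integrable continuous_on_mult continuous_on_const cf cg cs)
        (simp add: mult.assoc)
    finally show ?thesis unfolding ps[of y] V_def by (simp add: algebra_simps)
  qed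
  have UV: "ln U - ln V \<le> (1 - l / (1 + R)) * w"
  proof -
    \<comment> \<open>As a function of \<open>F / G\<close>, the quotient \<open>U / V\<close> is
      nonincreasing. By \<open>A\<close> the worst case is \<open>F / G = exp m\<close>, where it
      equals \<open>l + (1 - l) * exp w\<close>.\<close>
    have "U \<le> (l + (1 - l) * exp w) * V"
    proof -
      have "(l + (1 - l) * exp w) * V - U = l * (1 - l) * (exp w - 1) * (F / G - exp m)"
        unfolding U_def V_def exp_add by algebra
      moreover have "0 \<le> l * (1 - l) * (exp w - 1) * (F / G - exp m)"
        using l l1 A w by simp
      ultimately show ?thesis by linarith
    qed
    moreover have W: "0 < l + (1 - l) * exp w" using l(1) l1 by (simp add: add_pos_nonneg)
    ultimately have "ln U \<le> ln (l + (1 - l) * exp w) + ln V"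
      using U0 V0 by (simp flip: ln_mult_pos)
    then show ?thesis using log_mixture_le[OF l(1) l1 w] by linarith
  qed
  have d: "log_op k f y - log_op k g y = ln (q y) - ln (p y)" for y
    by (simp add: log_op_def p_def q_def)
  have "ln (p y) \<le> ln U + ln (q y)" for y
    using up[of y] bf(4)[of y] bg(4)[of y] U0 by (simp flip: ln_mult_pos)
  then have 1: "- ln U \<le> log_op k f y - log_op k g y" for y
    unfolding d by (smt (verit))
  have "ln V + ln (q y) \<le> ln (p y)" for y
    using lo[of y] bf(4)[of y] bg(4)[of y] V0 by (simp flip: ln_mult_pos)
  then have "log_op k f y - log_op k g y \<le> - ln V" for y
    unfolding d by (smt (verit))
  then have 2: "log_op k f y - log_op k g y \<le> - ln U + (1 - l / (1 + R)) * w" for y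
    using UV by (smt (verit))
  show ?thesis using that[of "- ln U"] 1 2 by blast
qed

text \<open>\<open>log_op k\<close> shrinks oscillations but only flips the sign of constant shifts.
  The iteration therefore uses \<open>N\<close>, normalised to vanish at a base point
  \<open>z\<close>; its limit solves the equation up to a constant factor, which a final shift
  removes.\<close>

lemma exists_scaling:
  fixes k :: "'a \<Rightarrow> 'a \<Rightarrow> real"
  assumes k: "continuous_on UNIV (\<lambda>(x, y). k x y)" and l: "0 < l" "\<And>x y. l \<le> k x y" "\<And>x y. k x y \<le> 1"
  obtains f where "continuous_on UNIV f" "\<And>y. exp (f y) * (\<integral>x. exp (f x) * k x y \<partial>\<mu>) = 1"
proof -
  define z :: 'a where "z = undefined"
  define N where "N = (\<lambda>f y. log_op k f y - log_op k f z)"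
  define u where "u = (\<lambda>n. (N ^^ n) (\<lambda>_. 0))"
  have u0: "u 0 = (\<lambda>_. 0)" and uS: "u (Suc n) = N (u n)" for n by (simp_all add: u_def)
  have cN: "continuous_on UNIV (N f)" if "continuous_on UNIV f" for f
    unfolding N_def by (intro continuous_intros continuous_log_op[OF k l that])
  have cu: "continuous_on UNIV (u n)" for n
    by (induction n) (simp_all add: u0 uS cN)
  have uz: "u n z = 0" for n by (cases n) (simp_all add: u0 uS N_def)
  obtain B where B: "0 \<le> B" "\<And>x. \<bar>u 1 x\<bar> \<le> B" using continuous_bounded[OF cu] by blast
  \<comment> \<open>The first increment is \<open>u 1\<close>, with values between
    \<open>- B\<close> and \<open>B\<close>, so its oscillation is at most \<open>2 * B\<close>.
    Later oscillations do not exceed this, so a single factor \<open>\<kappa>\<close> serves all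
    steps.\<close>
  define R where "R = 2 * B"
  define \<kappa> where "\<kappa> = 1 - l / (1 + R)"
  have l1: "l \<le> 1" using l(2,3) order_trans by blast
  have R: "0 \<le> R" using B by (simp add: R_def)
  have \<kappa>: "0 \<le> \<kappa>" "\<kappa> < 1"
    using l(1) l1 R by (auto simp: \<kappa>_def field_simps)
  have osc: "\<exists>m. \<forall>x. m \<le> u (Suc n) x - u n x \<and> u (Suc n) x - u n x \<le> m + \<kappa> ^ n * R" for n
  proof (induction n)
    case 0
    show ?case using B(2) by (intro exI[of _ "- B"]) (auto simp: u0 R_def abs_le_iff minus_le_iff)
  next
    case (Suc n)
    then obtain m where m: "\<And>x. m \<le> u (Suc n) x - u n x"
      "\<And>x. u (Suc n) x - u n x \<le> m + \<kappa> ^ n * R" by blast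
    have "0 \<le> \<kappa> ^ n * R" "\<kappa> ^ n * R \<le> R"
      using \<kappa> R by (auto intro!: mult_left_le_one_le power_le_one)
    from log_op_contraction[OF k l cu cu m this]
    obtain m' where m': "\<And>y. m' \<le> log_op k (u (Suc n)) y - log_op k (u n) y"
      "\<And>y. log_op k (u (Suc n)) y - log_op k (u n) y \<le> m' + \<kappa> * (\<kappa> ^ n * R)"
      unfolding \<kappa>_def by blast
    show ?case
      using m' by (intro exI[of _ "m' - (log_op k (u (Suc n)) z - log_op k (u n) z)"])
        (simp add: uS[of "Suc n"] uS[of n, symmetric] N_def uS[of n] algebra_simps)
  qed
  have step: "\<bar>u (Suc n) x - u n x\<bar> \<le> \<kappa> ^ n * R" for n x
  proof -
    obtain m where m: "\<And>x. m \<le> u (Suc n) x - u n x"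
      "\<And>x. u (Suc n) x - u n x \<le> m + \<kappa> ^ n * R" using osc by blast
    \<comment> \<open>The increment vanishes at \<open>z\<close>, so the interval that contains its
      values also contains 0, and the oscillation bounds the absolute value.\<close>
    from m[of z] m[of x] show ?thesis by (simp add: uz)
  qed
  have sm: "summable (\<lambda>n. \<kappa> ^ n * R)" using \<kappa> by (intro summable_mult2 summable_geometric) auto
  define f where "f = (\<lambda>x. \<Sum>n. u (Suc n) x - u n x)"
  have tele: "(\<Sum>i<n. u (Suc i) x - u i x) = u n x" for n x
    using sum_lessThan_telescope[of "\<lambda>i. u i x" n] by (simp add: u0)
  have "uniform_limit UNIV (\<lambda>n x. \<Sum>i<n. u (Suc i) x - u i x) f sequentially"
    unfolding f_def using step sm by (intro Weierstrass_m_test) auto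
  then have ul: "uniform_limit UNIV u f sequentially"
    unfolding tele by simp
  have cf: "continuous_on UNIV f"
    using ul cu by (intro uniform_limit_theorem[OF _ ul]) auto
  have lim: "(\<lambda>n. u n x) \<longlonglongrightarrow> f x" for x
    using tendsto_uniform_limitI[OF ul] by simp
  define S where "S = (\<Sum>n. \<kappa> ^ n * R)"
  have bound: "u n x \<le> S" for n x
  proof -
    have "u n x = (\<Sum>i<n. u (Suc i) x - u i x)" by (simp add: tele)
    also have "\<dots> \<le> (\<Sum>i<n. \<kappa> ^ i * R)" using step abs_le_D1 by (intro sum_mono) blast
    also have "\<dots> \<le> S" unfolding S_def using \<kappa> R by (intro sum_le_suminf sm) auto
    finally show ?thesis .
  qed
  have plim: "(\<lambda>n. \<integral>x. exp (u n x) * k x y \<partial>\<mu>) \<longlonglongrightarrow> (\<integral>x. exp (f x) * k x y \<partial>\<mu>)" for y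
  proof (rule integral_dominated_convergence[where w = "\<lambda>_. exp S"])
    have "continuous_on UNIV (\<lambda>x. exp (v x) * k x y)" if "continuous_on UNIV v" for v
      using that kernel_continuous_left[OF k] by (intro continuous_intros)
    then show "(\<lambda>x. exp (f x) * k x y) \<in> borel_measurable \<mu>"
      "\<And>n. (\<lambda>x. exp (u n x) * k x y) \<in> borel_measurable \<mu>"
      using cf cu continuous_measurable by blast+
    show "AE x in \<mu>. (\<lambda>n. exp (u n x) * k x y) \<longlonglongrightarrow> exp (f x) * k x y"
      using lim by (intro AE_I2 tendsto_intros)
    have "exp (u n x) * k x y \<le> exp S * 1" for n x
      using bound l(1) l(2,3)[of x y] by (intro mult_mono) auto
    then show "AE x in \<mu>. norm (exp (u n x) * k x y) \<le> exp S" for n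
      using less_le_trans[OF l(1,2)] by (intro AE_I2) (simp add: abs_mult abs_of_pos)
  qed simp
  have "(\<lambda>n. log_op k (u n) y) \<longlonglongrightarrow> log_op k f y" for y
    unfolding log_op_def using integral_exp_kernel_bounds(4)[OF k l cf, of y]
    by (intro tendsto_intros plim) auto
  then have "(\<lambda>n. u (Suc n) y) \<longlonglongrightarrow> N f y" for y
    unfolding uS N_def by (intro tendsto_intros)
  then have fN: "f y = N f y" for y
    using LIMSEQ_unique LIMSEQ_Suc[OF lim] by blast
  define t where "t = log_op k f z"
  have eq: "exp (f y) * (\<integral>x. exp (f x) * k x y \<partial>\<mu>) = exp (- t)" for y
  proof -
    have "f y + t = - ln (\<integral>x. exp (f x) * k x y \<partial>\<mu>)" using fN[of y] by (simp add: N_def t_def log_op_def)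
    then have "(\<integral>x. exp (f x) * k x y \<partial>\<mu>) = exp (- (f y + t))"
      using integral_exp_kernel_bounds(4)[OF k l cf, of y] by simp
    then show ?thesis by (simp flip: exp_add)
  qed
  \<comment> \<open>A shift by \<open>t / 2\<close> enters both the outer exponential and the
    integral; together they give the factor \<open>exp t\<close> that cancels
    \<open>exp (- t)\<close>.\<close>
  show ?thesis
  proof (rule that[of "\<lambda>x. f x + t / 2"])
    show "continuous_on UNIV (\<lambda>x. f x + t / 2)" by (intro continuous_intros cf)
    fix y
    have "(\<integral>x. exp (f x + t / 2) * k x y \<partial>\<mu>) = exp (t / 2) * (\<integral>x. exp (f x) * k x y \<partial>\<mu>)"
      by (subst integral_mult_right_zero[symmetric]) (simp add: exp_add mult_ac)
    then have "exp (f y + t / 2) * (\<integral>x. exp (f x + t / 2) * k x y \<partial>\<mu>)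
        = exp (t / 2) * exp (t / 2) * (exp (f y) * (\<integral>x. exp (f x) * k x y \<partial>\<mu>))"
      by (simp add: exp_add)
    then show "exp (f y + t / 2) * (\<integral>x. exp (f x + t / 2) * k x y \<partial>\<mu>) = 1"
      unfolding eq by (simp flip: exp_add)
  qed
qed

end

section \<open>Uniqueness by a maximum principle\<close>

context compact_prob_space
begin

text \<open>With the weights \<open>w x y\<close>, the two equations say that
  \<open>exp (- h y)\<close> is the weighted mean of \<open>exp (h x)\<close>. So \<open>- h\<close>
  stays between the minimum and the maximum of \<open>h\<close>, and these extremes are opposite
  numbers.\<close>

lemma scaling_unique:
  fixes k :: "'a \<Rightarrow> 'a \<Rightarrow> real"
  assumes k: "continuous_on UNIV (\<lambda>(x, y). k x y)" and kpos: "\<And>x y. 0 < k x y"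
    and f: "continuous_on UNIV f" "\<And>y. exp (f y) * (\<integral>x. exp (f x) * k x y \<partial>\<mu>) = 1"
    and g: "continuous_on UNIV g" "\<And>y. exp (g y) * (\<integral>x. exp (g x) * k x y \<partial>\<mu>) = 1"
  shows "f = g"
proof -
  define h where "h = (\<lambda>x. f x - g x)"
  have ch: "continuous_on UNIV h" unfolding h_def by (intro continuous_intros f g)
  obtain x1 where x1: "\<And>x. h x \<le> h x1"
    using continuous_attains_sup[OF compact_UNIV _ ch] by auto
  obtain x0 where x0: "\<And>x. h x0 \<le> h x"
    using continuous_attains_inf[OF compact_UNIV _ ch] by auto
  define w where "w = (\<lambda>x y. exp (g x) * k x y)"
  have cw: "continuous_on UNIV (\<lambda>x. w x y)" for y
    unfolding w_def by (intro continuous_intros g kernel_continuous_left k)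
  have wpos: "0 < w x y" "0 \<le> w x y" for x y by (simp_all add: w_def kpos less_imp_le)
  have ce: "continuous_on UNIV (\<lambda>x. exp (h x))" by (intro continuous_intros ch)
  have iw: "(\<integral>x. w x y \<partial>\<mu>) = exp (- g y)" for y
    using g(2)[of y] by (simp add: w_def exp_minus field_simps)
  have iv: "(\<integral>x. exp (h x) * w x y \<partial>\<mu>) = exp (- f y)" for y
    using f(2)[of y] by (simp add: w_def h_def exp_diff exp_minus field_simps)
  have up: "- h y \<le> h x1" for y
  proof -
    have "(\<integral>x. exp (h x) * w x y \<partial>\<mu>) \<le> (\<integral>x. exp (h x1) * w x y \<partial>\<mu>)"
      using x1 wpos
      by (intro integral_mono continuous_integrable continuous_on_mult continuous_on_const ce cw
          mult_right_mono) auto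
    then have "exp (- f y) \<le> exp (h x1 - g y)" by (simp add: iv iw exp_diff exp_minus field_simps)
    then show ?thesis by (simp add: h_def)
  qed
  have lo: "h x0 \<le> - h y" for y
  proof -
    have "(\<integral>x. exp (h x0) * w x y \<partial>\<mu>) \<le> (\<integral>x. exp (h x) * w x y \<partial>\<mu>)"
      using x0 wpos
      by (intro integral_mono continuous_integrable continuous_on_mult continuous_on_const ce cw
          mult_right_mono) auto
    then have "exp (h x0 - g y) \<le> exp (- f y)" by (simp add: iv iw exp_diff exp_minus field_simps)
    then show ?thesis by (simp add: h_def)
  qed
  have eq: "h x0 = - h x1" using up[of x0] lo[of x1] by simp
  have cd: "continuous_on UNIV (\<lambda>x. (exp (h x1) - exp (h x)) * w x x0)"
    by (intro continuous_on_mult continuous_on_diff continuous_on_const ce cw)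
  \<comment> \<open>At the minimum point \<open>x0\<close> the mean is
    \<open>exp (- h x0) = exp (h x1)\<close>, the maximum of the averaged function, which is
    therefore attained almost everywhere.\<close>
  have "(\<integral>x. (exp (h x1) - exp (h x)) * w x x0 \<partial>\<mu>)
      = (\<integral>x. exp (h x1) * w x x0 - exp (h x) * w x x0 \<partial>\<mu>)"
    by (simp add: left_diff_distrib)
  also have "\<dots> = exp (h x1) * exp (- g x0) - exp (- f x0)"
    by (subst Bochner_Integration.integral_diff)
      (auto simp: iw iv intro!: continuous_integrable continuous_on_mult continuous_on_const ce cw)
  also have "\<dots> = 0" using eq by (simp add: h_def flip: exp_add)
  finally have "AE x in \<mu>. (exp (h x1) - exp (h x)) * w x x0 = 0"
    using x1 wpos
    by (subst (asm) integral_nonneg_eq_0_iff_AE) (auto intro: continuous_integrable cd)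
  then have ae: "AE x in \<mu>. h x = h x1"
    by eventually_elim (use wpos in \<open>simp add: less_imp_neq[symmetric]\<close>)
  \<comment> \<open>The support of \<open>\<mu>\<close> may be smaller than the space, so nothing is
    known yet at a given point. The mean at \<open>x1\<close> now gives
    \<open>- h x1 = h x1\<close>, so both extremes vanish.\<close>
  have "AE x in \<mu>. exp (h x) * w x x1 = exp (h x1) * w x x1" using ae by eventually_elim simp
  then have "exp (- f x1) = (\<integral>x. exp (h x1) * w x x1 \<partial>\<mu>)"
    unfolding iv[symmetric]
    by (intro integral_cong_AE continuous_measurable continuous_on_mult continuous_on_const ce cw)
  then have "exp (- f x1) = exp (h x1 - g x1)" by (simp add: iw exp_diff exp_minus field_simps)
  then have "h x1 = 0" by (simp add: h_def)
  then have "h x = 0" for x using x0[of x] x1[of x] eq by simp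
  then show ?thesis by (auto simp: h_def fun_eq_iff)
qed

end


section \<open>Kernel mean embedding\<close>

context rkhs
begin

lemma diff_mem: "f \<in> H \<Longrightarrow> g \<in> H \<Longrightarrow> (\<lambda>x. f x - g x) \<in> H"
  using add_mem[OF _ scale_mem[of g "-1"], of f] by simp

lemma ip_diff_left:
  "f \<in> H \<Longrightarrow> g \<in> H \<Longrightarrow> h \<in> H \<Longrightarrow> ip (\<lambda>x. f x - g x) h = ip f h - ip g h"
  using ip_add_left[OF _ scale_mem[of g "-1"], of f h] ip_scale_left[of g h "-1"] by simp

lemma kernel_commute: "k x y = k y x"
  using reproducing[OF kernel_mem] ip_commute[OF kernel_mem kernel_mem] by metis

lemma Cauchy_Schwarz:
  assumes f: "f \<in> H" and g: "g \<in> H"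
  shows "(ip f g)\<^sup>2 \<le> ip f f * ip g g"
proof (cases "ip g g = 0")
  case True
  then have "g = (\<lambda>x. 0 * g x)" using ip_definite g by auto
  then have "ip g f = 0" using ip_scale_left[OF g f, of 0] by simp
  then show ?thesis using ip_commute[OF f g] True by simp
next
  case False
  then have pos: "0 < ip g g" using ip_nonneg[OF g] by simp
  \<comment> \<open>\<open>t * g\<close> is the orthogonal projection of \<open>f\<close> onto the
    line of \<open>g\<close>; the inequality is the nonnegativity of the squared norm of the
    remainder \<open>d\<close>.\<close>
  define t where "t = ip f g / ip g g"
  define tg where "tg = (\<lambda>x. t * g x)"
  have tg: "tg \<in> H" unfolding tg_def by (rule scale_mem[OF g])
  define d where "d = (\<lambda>x. f x - tg x)"
  have d: "d \<in> H" unfolding d_def by (rule diff_mem[OF f tg])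
  have sc: "ip tg h = t * ip g h" if "h \<in> H" for h
    unfolding tg_def by (rule ip_scale_left[OF g that])
  have dl: "ip d h = ip f h - t * ip g h" if "h \<in> H" for h
    unfolding d_def using ip_diff_left[OF f tg that] sc[OF that] by simp
  have "ip d d = ip d f - t * ip d g"
    using dl[OF d] ip_commute[OF d f] ip_commute[OF d g] by simp
  also have "\<dots> = ip f f - t * ip f g - t * (ip f g - t * ip g g)"
    using dl[OF f] dl[OF g] ip_commute[OF f g] by simp
  also have "\<dots> = ip f f - (ip f g)\<^sup>2 / ip g g"
    using pos by (simp add: t_def field_simps power2_eq_square)
  finally have "(ip f g)\<^sup>2 / ip g g \<le> ip f f" using ip_nonneg[OF d] by simp
  then show ?thesis using pos by (simp add: pos_divide_le_eq)
qed

text \<open>Cauchy-Schwarz against the kernel section at \<open>x\<close>, whose squared norm is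
  \<open>k x x\<close>.\<close>

lemma evaluation_bound:
  assumes "f \<in> H" "k x x \<le> 1"
  shows "\<bar>f x\<bar> \<le> ip_norm ip f"
proof -
  have "(f x)\<^sup>2 \<le> ip f f * k x x"
    using Cauchy_Schwarz[OF assms(1) kernel_mem[of x]] reproducing[OF assms(1)]
      reproducing[OF kernel_mem] by simp
  also have "\<dots> \<le> ip f f" using assms ip_nonneg by (simp add: mult_left_le)
  finally show ?thesis unfolding ip_norm_def using real_le_rsqrt by fastforce
qed

lemma finite_combination:
  assumes "finite S"
  shows "(\<lambda>y. \<Sum>z\<in>S. w z * k z y) \<in> H"
    and "h \<in> H \<Longrightarrow> ip (\<lambda>y. \<Sum>z\<in>S. w z * k z y) h = (\<Sum>z\<in>S. w z * h z)"
proof -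
  have "(\<lambda>y. \<Sum>z\<in>S. w z * k z y) \<in> H \<and>
      (\<forall>h\<in>H. ip (\<lambda>y. \<Sum>z\<in>S. w z * k z y) h = (\<Sum>z\<in>S. w z * h z))"
    using assms
  proof induction
    case empty
    have "ip (\<lambda>_. 0) h = 0" if "h \<in> H" for h
      using ip_scale_left[OF zero_mem that, of 0] by simp
    then show ?case using zero_mem by simp
  next
    case (insert z S)
    have "ip (k z) h = h z" if "h \<in> H" for h
      using reproducing[OF that, of z] ip_commute[OF that kernel_mem] by simp
    with insert show ?case
      by (simp add: add_mem scale_mem kernel_mem ip_add_left ip_scale_left)
  qed
  then show "(\<lambda>y. \<Sum>z\<in>S. w z * k z y) \<in> H"
    and "h \<in> H \<Longrightarrow> ip (\<lambda>y. \<Sum>z\<in>S. w z * k z y) h = (\<Sum>z\<in>S. w z * h z)" by blast+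
qed

end

context compact_prob_space
begin

text \<open>
  The \<open>H\<close>-valued integral of \<open>a x * k x\<close> is constructed as a limit of Riemann sums. They
  are Cauchy in \<open>H\<close> because, by the reproducing property, the squared distance of two of them
  is controlled by their uniform distance.
\<close>

lemma kernel_mean_embedding:
  fixes k :: "'a \<Rightarrow> 'a \<Rightarrow> real"
  assumes "rkhs k H ip" and k: "continuous_on UNIV (\<lambda>(x, y). k x y)"
    and Hc: "\<And>h. h \<in> H \<Longrightarrow> continuous_on UNIV h" and a: "continuous_on UNIV a"
  shows "(\<lambda>y. \<integral>x. a x * k x y \<partial>\<mu>) \<in> H"
    and "h \<in> H \<Longrightarrow> ip (\<lambda>y. \<integral>x. a x * k x y \<partial>\<mu>) h = (\<integral>x. a x * h x \<partial>\<mu>)"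
proof -
  interpret rkhs k H ip by fact
  obtain g :: "nat \<Rightarrow> 'a \<Rightarrow> 'a" where g: "\<And>n. finite (range (g n))"
    "\<And>n z. g n -` {z} \<in> sets \<mu>" "\<And>n x. dist (g n x) x < 1 / real (Suc n)"
    "\<And>x. (\<lambda>n. g n x) \<longlonglongrightarrow> x" using quantisation_sequence by metis
  note iq = integral_quantised[OF g(1,2)]
  define s where "s n y = (\<integral>x. a (g n x) * k (g n x) y \<partial>\<mu>)" for n y
  have s_eq: "s n = (\<lambda>y. \<Sum>z\<in>range (g n). (a z * measure \<mu> (g n -` {z})) * k z y)" for n
    unfolding s_def using iq(1)[of "\<lambda>z. a z * k z _" n] by (simp add: fun_eq_iff mult_ac)
  have sH: "s n \<in> H" for n unfolding s_eq by (rule finite_combination(1)[OF g(1)])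
  have ips: "ip (s n) h = (\<integral>x. a (g n x) * h (g n x) \<partial>\<mu>)" if "h \<in> H" for n h
    unfolding s_eq using iq(1)[of "\<lambda>z. a z * h z" n]
    by (subst finite_combination(2)[OF g(1) that]) (simp add: mult_ac)
  obtain A where A: "0 \<le> A" "\<And>x. \<bar>a x\<bar> \<le> A" using continuous_bounded[OF a] by blast
  have lim: "(\<lambda>n. ip (s n) h) \<longlonglongrightarrow> (\<integral>x. a x * h x \<partial>\<mu>)" if h: "h \<in> H" for h
  proof -
    obtain B where B: "0 \<le> B" "\<And>x. \<bar>h x\<bar> \<le> B" using continuous_bounded[OF Hc[OF h]] by blast
    show ?thesis unfolding ips[OF h]
    proof (rule integral_dominated_convergence[where w = "\<lambda>_. A * B"])
      show "(\<lambda>x. a x * h x) \<in> borel_measurable \<mu>"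
        by (intro continuous_measurable continuous_on_mult a Hc h)
      show "(\<lambda>x. a (g n x) * h (g n x)) \<in> borel_measurable \<mu>" for n
        using iq(2)[of "\<lambda>z. a z * h z" n] by blast
      show "AE x in \<mu>. (\<lambda>n. a (g n x) * h (g n x)) \<longlonglongrightarrow> a x * h x"
        using continuous_on_tendsto_compose[OF a g(4)] continuous_on_tendsto_compose[OF Hc[OF h] g(4)]
        by (intro AE_I2 tendsto_mult) auto
      show "AE x in \<mu>. norm (a (g n x) * h (g n x)) \<le> A * B" for n
        using A B by (intro AE_I2) (auto simp: abs_mult intro!: mult_mono)
    qed simp
  qed
  \<comment> \<open>Uniform continuity on the compact product makes the Riemann sums uniformly close
    in \<open>y\<close> once the mesh is small.\<close>
  have "uniformly_continuous_on (UNIV :: ('a \<times> 'a) set) (\<lambda>(x, y). a x * k x y)"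
  proof (rule compact_uniformly_continuous)
    show "compact (UNIV :: ('a \<times> 'a) set)"
      using compact_Times[OF compact_UNIV compact_UNIV] by simp
    have "continuous_on UNIV (\<lambda>p::'a \<times> 'a. a (fst p))"
      using continuous_on_compose2[OF a, of UNIV fst] by (simp add: continuous_intros)
    moreover have "continuous_on UNIV (\<lambda>p. k (fst p) (snd p))"
      using k by (simp add: case_prod_beta')
    ultimately show "continuous_on UNIV (\<lambda>(x, y). a x * k x y)"
      by (simp add: case_prod_beta' continuous_on_mult)
  qed
  note uc = this[unfolded uniformly_continuous_on_def]
  have cauchy: "\<forall>e>0. \<exists>N. \<forall>m\<ge>N. \<forall>n\<ge>N. sqrt (ip (\<lambda>x. s m x - s n x) (\<lambda>x. s m x - s n x)) < e"
  proof (intro allI impI)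
    fix e :: real assume e: "0 < e"
    \<comment> \<open>The squared distance of two sums will be at most
      \<open>2 * A * \<eta>\<close>, which this choice keeps below the square of \<open>e\<close>;
      \<open>A + 1\<close> guards against \<open>A = 0\<close>.\<close>
    define \<eta> where "\<eta> = e\<^sup>2 / (4 * (A + 1))"
    have \<eta>: "0 < \<eta>" using e A(1) by (simp add: \<eta>_def)
    then obtain d where d: "0 < d"
      "\<And>p p'. dist p' p < d \<Longrightarrow> dist ((\<lambda>(x, y). a x * k x y) p') ((\<lambda>(x, y). a x * k x y) p) < \<eta>"
      using uc[rule_format, OF \<eta>] by blast
    obtain N where N: "1 / real (Suc N) < d / 2" using nat_approx_posE[of "d / 2"] d(1) by auto
    have close: "\<bar>s m y - s n y\<bar> \<le> \<eta>" if "N \<le> m" "N \<le> n" for m n y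
    proof -
      have le: "1 / real (Suc i) \<le> 1 / real (Suc N)" if "N \<le> i" for i
        using that by (intro divide_left_mono) auto
      have pt: "\<bar>a (g m x) * k (g m x) y - a (g n x) * k (g n x) y\<bar> \<le> \<eta>" for x
      proof -
        have "dist (g m x) (g n x) \<le> dist (g m x) x + dist (g n x) x" by (rule dist_triangle2)
        also have "\<dots> < d" using g(3)[of m x] g(3)[of n x] le[OF that(1)] le[OF that(2)] N by linarith
        finally have "dist (g m x, y) (g n x, y) < d" by (simp add: dist_Pair_Pair)
        from d(2)[OF this] show ?thesis by (simp add: dist_real_def)
      qed
      have "s m y - s n y = (\<integral>x. a (g m x) * k (g m x) y - a (g n x) * k (g n x) y \<partial>\<mu>)"
        unfolding s_def using iq(2)[of "\<lambda>z. a z * k z y"]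
        by (subst Bochner_Integration.integral_diff) auto
      also have "\<bar>\<dots>\<bar> \<le> (\<integral>x. \<bar>a (g m x) * k (g m x) y - a (g n x) * k (g n x) y\<bar> \<partial>\<mu>)"
        by (rule integral_abs_bound)
      also have "\<dots> \<le> (\<integral>x. \<eta> \<partial>\<mu>)"
        using iq(2)[of "\<lambda>z. a z * k z y"] pt
        by (intro integral_mono Bochner_Integration.integrable_abs Bochner_Integration.integrable_diff) auto
      finally show ?thesis by (simp add: prob_space)
    qed
    have "sqrt (ip (\<lambda>x. s m x - s n x) (\<lambda>x. s m x - s n x)) < e" if mn: "N \<le> m" "N \<le> n" for m n
    proof -
      define f where "f = (\<lambda>x. s m x - s n x)"
      have fH: "f \<in> H" unfolding f_def by (rule diff_mem[OF sH sH])
      have fb: "\<bar>f x\<bar> \<le> \<eta>" for x unfolding f_def by (rule close[OF mn])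
      have b: "\<bar>\<integral>x. a (g i x) * f (g i x) \<partial>\<mu>\<bar> \<le> A * \<eta>" for i
      proof -
        have "\<bar>\<integral>x. a (g i x) * f (g i x) \<partial>\<mu>\<bar> \<le> (\<integral>x. \<bar>a (g i x) * f (g i x)\<bar> \<partial>\<mu>)"
          by (rule integral_abs_bound)
        also have "\<dots> \<le> (\<integral>x. A * \<eta> \<partial>\<mu>)"
          using iq(2)[of "\<lambda>z. a z * f z" i] A fb \<eta>
          by (intro integral_mono Bochner_Integration.integrable_abs) (auto simp: abs_mult intro!: mult_mono)
        finally show ?thesis by (simp add: prob_space)
      qed
      have "ip f f = ip (s m) f - ip (s n) f"
        using ip_diff_left[OF sH sH fH, of m n] by (simp add: f_def)
      also have "\<dots> \<le> 2 * (A * \<eta>)" unfolding ips[OF fH] using b[of m] b[of n] by linarith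
      also have "\<dots> < e\<^sup>2"
      proof -
        have "2 * (A * \<eta>) = e\<^sup>2 * (A / (2 * (A + 1)))"
          using A(1) by (simp add: \<eta>_def field_simps)
        also have "\<dots> < e\<^sup>2 * 1" using e A(1) by (intro mult_strict_left_mono) auto
        finally show ?thesis by simp
      qed
      finally show ?thesis using e unfolding f_def[symmetric] by (intro real_less_lsqrt) auto
    qed
    then show "\<exists>N. \<forall>m\<ge>N. \<forall>n\<ge>N. sqrt (ip (\<lambda>x. s m x - s n x) (\<lambda>x. s m x - s n x)) < e" by blast
  qed
  obtain f where f: "f \<in> H" "(\<lambda>n. sqrt (ip (\<lambda>x. s n x - f x) (\<lambda>x. s n x - f x))) \<longlonglongrightarrow> 0"
    using complete[OF sH cauchy] by blast
  have ipf: "ip f h = (\<integral>x. a x * h x \<partial>\<mu>)" if h: "h \<in> H" for h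
  proof -
    have "(\<lambda>n. ip (s n) h - ip f h) \<longlonglongrightarrow> 0"
    proof (rule Lim_null_comparison)
      show "(\<lambda>n. sqrt (ip (\<lambda>x. s n x - f x) (\<lambda>x. s n x - f x)) * sqrt (ip h h)) \<longlonglongrightarrow> 0"
        using tendsto_mult_right[OF f(2), of "sqrt (ip h h)"] by simp
      have "\<bar>ip (s n) h - ip f h\<bar> \<le> sqrt (ip (\<lambda>x. s n x - f x) (\<lambda>x. s n x - f x)) * sqrt (ip h h)" for n
      proof -
        have "(ip (s n) h - ip f h)\<^sup>2 \<le> ip (\<lambda>x. s n x - f x) (\<lambda>x. s n x - f x) * ip h h"
          using Cauchy_Schwarz[OF diff_mem[OF sH f(1)] h, of n]
          by (simp only: ip_diff_left[OF sH f(1) h])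
        then have "sqrt ((ip (s n) h - ip f h)\<^sup>2)
            \<le> sqrt (ip (\<lambda>x. s n x - f x) (\<lambda>x. s n x - f x) * ip h h)"
          by (rule real_sqrt_le_mono)
        then show ?thesis by (simp add: real_sqrt_mult)
      qed
      then show "\<forall>\<^sub>F n in sequentially. norm (ip (s n) h - ip f h)
          \<le> sqrt (ip (\<lambda>x. s n x - f x) (\<lambda>x. s n x - f x)) * sqrt (ip h h)" by simp
    qed
    then have "(\<lambda>n. ip (s n) h) \<longlonglongrightarrow> ip f h" by (rule LIM_zero_cancel)
    then show ?thesis using lim[OF h] LIMSEQ_unique by blast
  qed
  \<comment> \<open>Testing the weak identity \<open>ipf\<close> on the kernel section at
    \<open>y\<close> identifies the abstract limit with the pointwise integral.\<close>
  have "f y = (\<integral>x. a x * k x y \<partial>\<mu>)" for y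
    using reproducing[OF f(1), of y] ipf[OF kernel_mem, of y] kernel_commute[of y] by simp
  then have eq: "(\<lambda>y. \<integral>x. a x * k x y \<partial>\<mu>) = f" by auto
  show "(\<lambda>y. \<integral>x. a x * k x y \<partial>\<mu>) \<in> H"
    and "h \<in> H \<Longrightarrow> ip (\<lambda>y. \<integral>x. a x * k x y \<partial>\<mu>) h = (\<integral>x. a x * h x \<partial>\<mu>)"
    unfolding eq using f(1) ipf by blast+
qed

end


section \<open>The Poisson equation for a Doeblin kernel\<close>

text \<open>\<open>q\<close> is the transition density of a reversible Markov chain with respect to
  \<open>\<mu>\<close>, and \<open>q_ge\<close> is its Doeblin minorisation: every transition law
  dominates \<open>\<delta>\<close> times \<open>\<mu>\<close>.\<close>

locale doeblin_kernel = compact_prob_space \<mu> for \<mu> :: "'a::metric_space measure" +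
  fixes q :: "'a \<Rightarrow> 'a \<Rightarrow> real" and \<delta> :: real
  assumes q_continuous: "continuous_on UNIV (\<lambda>(x, y). q x y)"
    and q_sym: "q x y = q y x"
    and \<delta>_pos: "0 < \<delta>"
    and q_ge: "\<delta> \<le> q x y"
    and q_integral: "(\<integral>x. q x y \<partial>\<mu>) = 1"
begin

definition K :: "('a \<Rightarrow> real) \<Rightarrow> 'a \<Rightarrow> real" where
  "K \<phi> y = (\<integral>x. \<phi> x * q x y \<partial>\<mu>)"

lemma q_left: "continuous_on UNIV (\<lambda>x. q x y)"
  by (rule kernel_continuous_left[OF q_continuous])

lemma continuous_mult_q: "continuous_on UNIV \<phi> \<Longrightarrow> continuous_on UNIV (\<lambda>x. \<phi> x * q x y)"
  by (intro continuous_on_mult q_left)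

lemma integrable_mult_q: "integrable \<mu> \<phi> \<Longrightarrow> integrable \<mu> (\<lambda>x. \<phi> x * q x y)"
  by (intro integrable_mult_continuous q_left)

lemma delta_le_1: "\<delta> \<le> 1"
proof -
  have "(\<integral>x. \<delta> \<partial>\<mu>) \<le> (\<integral>x. q x undefined \<partial>\<mu>)"
    by (intro integral_mono continuous_integrable q_left q_ge) auto
  then show ?thesis by (simp add: q_integral prob_space)
qed

lemma continuous_K: "integrable \<mu> \<phi> \<Longrightarrow> continuous_on UNIV (K \<phi>)"
  unfolding K_def[abs_def] by (intro continuous_kernel_integral q_continuous)

lemma K_const: "K (\<lambda>_. s) y = s"
  by (simp add: K_def q_integral)

lemma K_add: "integrable \<mu> \<phi> \<Longrightarrow> integrable \<mu> \<psi> \<Longrightarrow> K (\<lambda>x. \<phi> x + \<psi> x) y = K \<phi> y + K \<psi> y"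
  unfolding K_def distrib_right by (intro Bochner_Integration.integral_add integrable_mult_q)

lemma K_diff: "integrable \<mu> \<phi> \<Longrightarrow> integrable \<mu> \<psi> \<Longrightarrow> K (\<lambda>x. \<phi> x - \<psi> x) y = K \<phi> y - K \<psi> y"
  unfolding K_def left_diff_distrib by (intro Bochner_Integration.integral_diff integrable_mult_q)

text \<open>Invariance of \<open>\<mu>\<close>: after Fubini, symmetry turns the integral of
  \<open>q\<close> over its second variable into 1. It keeps the Neumann iterates at mean
  zero.\<close>

lemma integral_K:
  assumes "continuous_on UNIV \<phi>"
  shows "(\<integral>y. K \<phi> y \<partial>\<mu>) = (\<integral>x. \<phi> x \<partial>\<mu>)"
proof -
  have "continuous_on UNIV (\<lambda>p::'a \<times> 'a. \<phi> (fst p))"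
    using continuous_on_compose2[OF assms, of UNIV fst] by (simp add: continuous_intros)
  moreover have "continuous_on UNIV (\<lambda>p. q (fst p) (snd p))"
    using q_continuous by (simp add: case_prod_beta')
  ultimately have "continuous_on UNIV (\<lambda>(x, y). \<phi> x * q x y)"
    by (simp add: case_prod_beta' continuous_on_mult)
  from Fubini_kernel[OF this] have "(\<integral>y. K \<phi> y \<partial>\<mu>) = (\<integral>x. \<phi> x * (\<integral>y. q x y \<partial>\<mu>) \<partial>\<mu>)"
    by (simp add: K_def)
  also have "\<dots> = (\<integral>x. \<phi> x \<partial>\<mu>)" by (subst q_sym) (simp add: q_integral)
  finally show ?thesis .
qed

text \<open>Against a function of mean zero, \<open>q\<close> may be replaced by
  \<open>q - \<delta>\<close>, which is nonnegative with integral
  \<open>1 - \<delta>\<close>.\<close>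

lemma K_contraction:
  assumes c: "continuous_on UNIV \<phi>" and mean: "(\<integral>x. \<phi> x \<partial>\<mu>) = 0" and B: "\<And>x. \<bar>\<phi> x\<bar> \<le> B"
  shows "\<bar>K \<phi> y\<bar> \<le> (1 - \<delta>) * B"
proof -
  have B0: "0 \<le> B" using B[of undefined] by simp
  have cq: "continuous_on UNIV (\<lambda>x. q x y - \<delta>)" by (intro continuous_intros q_left)
  have "(\<integral>x. \<phi> x * (q x y - \<delta>) \<partial>\<mu>) = (\<integral>x. \<phi> x * q x y - \<phi> x * \<delta> \<partial>\<mu>)"
    by (simp add: right_diff_distrib)
  also have "\<dots> = K \<phi> y"
    using mean unfolding K_def
    by (subst Bochner_Integration.integral_diff)
      (auto intro!: continuous_integrable continuous_mult_q c)
  finally have "\<bar>K \<phi> y\<bar> \<le> (\<integral>x. \<bar>\<phi> x * (q x y - \<delta>)\<bar> \<partial>\<mu>)"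
    using integral_abs_bound[of \<mu> "\<lambda>x. \<phi> x * (q x y - \<delta>)"] by simp
  also have "\<dots> \<le> (\<integral>x. B * (q x y - \<delta>) \<partial>\<mu>)"
    using B B0 q_ge
    by (intro integral_mono Bochner_Integration.integrable_abs continuous_integrable
        continuous_on_mult continuous_on_const c cq) (auto simp: abs_mult intro!: mult_mono)
  also have "\<dots> = B * (\<integral>x. q x y - \<delta> \<partial>\<mu>)" by simp
  also have "(\<integral>x. q x y - \<delta> \<partial>\<mu>) = 1 - \<delta>"
    by (subst Bochner_Integration.integral_diff) (auto simp: q_integral prob_space continuous_integrable q_left)
  finally show ?thesis by (simp add: mult.commute)
qed

text \<open>Neumann series of the powers of \<open>K\<close>. By \<open>K_contraction\<close> its
  terms are dominated by a geometric series with sum \<open>B / \<delta>\<close>.\<close>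

lemma Poisson_equation:
  assumes c: "continuous_on UNIV \<phi>" and mean: "(\<integral>x. \<phi> x \<partial>\<mu>) = 0" and B: "\<And>x. \<bar>\<phi> x\<bar> \<le> B"
  obtains \<psi> where "continuous_on UNIV \<psi>" "\<And>y. \<psi> y - K \<psi> y = \<phi> y" "\<And>x. \<bar>\<psi> x\<bar> \<le> B / \<delta>"
proof -
  define u where "u n = (K ^^ n) \<phi>" for n
  have u0: "u 0 = \<phi>" and uS: "u (Suc n) = K (u n)" for n by (simp_all add: u_def)
  have B0: "0 \<le> B" using B[of undefined] by simp
  have u: "continuous_on UNIV (u n) \<and> (\<integral>x. u n x \<partial>\<mu>) = 0 \<and> (\<forall>x. \<bar>u n x\<bar> \<le> (1 - \<delta>) ^ n * B)" for n
  proof (induction n)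
    case 0
    show ?case using assms by (simp add: u0)
  next
    case (Suc n)
    then have cn: "continuous_on UNIV (u n)" and mn: "(\<integral>x. u n x \<partial>\<mu>) = 0"
      and bn: "\<And>x. \<bar>u n x\<bar> \<le> (1 - \<delta>) ^ n * B" by auto
    show ?case
      using continuous_K[OF continuous_integrable[OF cn]] integral_K[OF cn] mn
        K_contraction[OF cn mn bn] by (simp add: uS mult_ac)
  qed
  then have cu: "continuous_on UNIV (u n)" and bu: "\<bar>u n x\<bar> \<le> (1 - \<delta>) ^ n * B" for n x by auto
  define S where "S n x = (\<Sum>i<n. u i x)" for n x
  have cS: "continuous_on UNIV (S n)" for n
    unfolding S_def[abs_def] by (intro continuous_on_sum cu)
  have d1: "\<bar>1 - \<delta>\<bar> < 1" "0 \<le> 1 - \<delta>" using \<delta>_pos delta_le_1 by auto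
  have geo: "(\<lambda>n. (1 - \<delta>) ^ n * B) sums (B / \<delta>)"
    using sums_mult2[OF geometric_sums[of "1 - \<delta>"], of B] d1 by simp
  have bS: "\<bar>S n x\<bar> \<le> B / \<delta>" for n x
  proof -
    have "\<bar>S n x\<bar> \<le> (\<Sum>i<n. (1 - \<delta>) ^ i * B)"
      unfolding S_def using bu by (intro order_trans[OF sum_abs] sum_mono)
    also have "\<dots> \<le> B / \<delta>"
      using geo d1 B0 sum_le_suminf[of "\<lambda>n. (1 - \<delta>) ^ n * B" "{..<n}"]
      by (auto simp: sums_iff)
    finally show ?thesis .
  qed
  define \<psi> where "\<psi> x = (\<Sum>i. u i x)" for x
  have ul: "uniform_limit UNIV S \<psi> sequentially"
    unfolding S_def[abs_def] \<psi>_def[abs_def] using bu geo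
    by (intro Weierstrass_m_test[where M = "\<lambda>n. (1 - \<delta>) ^ n * B"]) (auto simp: sums_iff)
  have c\<psi>: "continuous_on UNIV \<psi>"
    using cS by (intro uniform_limit_theorem[OF _ ul]) auto
  have lim: "(\<lambda>n. S n x) \<longlonglongrightarrow> \<psi> x" for x using tendsto_uniform_limitI[OF ul] by simp
  have b\<psi>: "\<bar>\<psi> x\<bar> \<le> B / \<delta>" for x
    using bS by (intro LIMSEQ_le_const2[OF tendsto_rabs[OF lim]]) blast
  \<comment> \<open>Applying \<open>K\<close> shifts the partial sums by one index and drops the
    term \<open>\<phi>\<close>; the limit of this identity is the equation.\<close>
  have KS: "K (S n) y = S (Suc n) y - \<phi> y" for n y
  proof (induction n)
    case 0
    show ?case using K_const[of 0] by (simp add: S_def[abs_def] u0)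
  next
    case (Suc n)
    have "K (S (Suc n)) y = K (S n) y + K (u n) y"
      using K_add[OF continuous_integrable[OF cS] continuous_integrable[OF cu], of n n y]
      by (simp add: S_def[abs_def])
    also have "\<dots> = S (Suc n) y - \<phi> y + u (Suc n) y" by (simp add: Suc uS)
    also have "\<dots> = S (Suc (Suc n)) y - \<phi> y" by (simp add: S_def)
    finally show ?case .
  qed
  have "\<psi> y - K \<psi> y = \<phi> y" for y
  proof -
    have "(\<lambda>n. K (S n) y) \<longlonglongrightarrow> K \<psi> y"
      unfolding K_def
    proof (rule integral_dominated_convergence[where w = "\<lambda>x. B / \<delta> * q x y"])
      show "(\<lambda>x. \<psi> x * q x y) \<in> borel_measurable \<mu>" "\<And>n. (\<lambda>x. S n x * q x y) \<in> borel_measurable \<mu>"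
        by (intro continuous_measurable continuous_mult_q c\<psi> cS)+
      show "integrable \<mu> (\<lambda>x. B / \<delta> * q x y)"
        by (intro continuous_integrable continuous_mult_q continuous_on_const)
      show "AE x in \<mu>. (\<lambda>n. S n x * q x y) \<longlonglongrightarrow> \<psi> x * q x y"
        by (intro AE_I2 tendsto_intros lim)
      have "0 \<le> q x y" for x using q_ge[of x y] \<delta>_pos by linarith
      then show "AE x in \<mu>. norm (S n x * q x y) \<le> B / \<delta> * q x y" for n
        using bS by (intro AE_I2) (auto simp: abs_mult simp del: times_divide_eq_left intro!: mult_right_mono)
    qed
    moreover have "(\<lambda>n. K (S n) y) \<longlonglongrightarrow> \<psi> y - \<phi> y"
      unfolding KS by (intro tendsto_intros LIMSEQ_Suc[OF lim])
    ultimately have "K \<psi> y = \<psi> y - \<phi> y" by (rule LIMSEQ_unique)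
    then show ?thesis by simp
  qed
  then show ?thesis using that c\<psi> b\<psi> by blast
qed

text \<open>Integration against the invariant measure forces \<open>r = 0\<close>. The centred
  function is then a fixed point of \<open>K\<close> of mean zero, and the contraction, evaluated
  where its modulus is largest, makes it vanish.\<close>

lemma harmonic_constant:
  assumes c: "continuous_on UNIV \<xi>" and eq: "\<And>y. \<xi> y = K \<xi> y + r"
  obtains s where "\<And>y. \<xi> y = s"
proof -
  have ci: "integrable \<mu> \<xi>" by (rule continuous_integrable[OF c])
  have cK: "continuous_on UNIV (K \<xi>)" by (rule continuous_K[OF ci])
  have "(\<integral>y. \<xi> y \<partial>\<mu>) = (\<integral>y. K \<xi> y + r \<partial>\<mu>)" by (subst eq) simp
  also have "\<dots> = (\<integral>y. \<xi> y \<partial>\<mu>) + r"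
    using continuous_integrable[OF cK] integral_K[OF c] by (simp add: prob_space)
  finally have r: "r = 0" by simp
  define s where "s = (\<integral>y. \<xi> y \<partial>\<mu>)"
  define \<eta> where "\<eta> x = \<xi> x - s" for x
  have c\<eta>: "continuous_on UNIV \<eta>" unfolding \<eta>_def[abs_def] by (intro continuous_intros c)
  have mean: "(\<integral>x. \<eta> x \<partial>\<mu>) = 0" using ci by (simp add: \<eta>_def s_def prob_space)
  have K\<eta>: "K \<eta> y = \<eta> y" for y
    using K_diff[OF ci, of "\<lambda>_. s" y] eq[of y] r by (simp add: \<eta>_def[abs_def] K_const)
  have "continuous_on UNIV (\<lambda>x. \<bar>\<eta> x\<bar>)" by (intro continuous_intros c\<eta>)
  then obtain x0 where x0: "\<And>x. \<bar>\<eta> x\<bar> \<le> \<bar>\<eta> x0\<bar>"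
    using continuous_attains_sup[OF compact_UNIV] by auto
  have "\<bar>\<eta> x0\<bar> \<le> (1 - \<delta>) * \<bar>\<eta> x0\<bar>"
    using K_contraction[OF c\<eta> mean x0, of x0] by (simp add: K\<eta>)
  then have "\<delta> * \<bar>\<eta> x0\<bar> \<le> 0" by (simp add: algebra_simps)
  then have "\<bar>\<eta> x0\<bar> \<le> 0" using \<delta>_pos by (simp add: mult_le_0_iff)
  then have "\<xi> y = s" for y using x0[of y] by (simp add: \<eta>_def)
  then show ?thesis by (rule that)
qed

text \<open>Positivity of the Dirichlet form: expand the integral of
  \<open>(\<psi> x - \<psi> y)\<^sup>2 * q x y\<close> over \<open>x\<close>, then integrate over
  \<open>y\<close> using invariance.\<close>

lemma integral_mult_K_le:
  assumes c: "continuous_on UNIV \<psi>"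
  shows "(\<integral>y. \<psi> y * K \<psi> y \<partial>\<mu>) \<le> (\<integral>y. (\<psi> y)\<^sup>2 \<partial>\<mu>)"
proof -
  have c2: "continuous_on UNIV (\<lambda>x. (\<psi> x)\<^sup>2)" by (intro continuous_intros c)
  have cK: "continuous_on UNIV (K \<psi>)" and cK2: "continuous_on UNIV (K (\<lambda>x. (\<psi> x)\<^sup>2))"
    by (intro continuous_K continuous_integrable c c2)+
  have pt: "2 * (\<psi> y * K \<psi> y) \<le> K (\<lambda>x. (\<psi> x)\<^sup>2) y + (\<psi> y)\<^sup>2" for y
  proof -
    have "0 \<le> (\<integral>x. (\<psi> x - \<psi> y)\<^sup>2 * q x y \<partial>\<mu>)"
      using q_ge \<delta>_pos by (intro Bochner_Integration.integral_nonneg) (meson mult_nonneg_nonneg zero_le_power2 less_imp_le less_le_trans)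
    also have "\<dots> = (\<integral>x. (\<psi> x)\<^sup>2 * q x y - 2 * \<psi> y * (\<psi> x * q x y) + (\<psi> y)\<^sup>2 * q x y \<partial>\<mu>)"
      by (simp add: power2_eq_square algebra_simps)
    also have "\<dots> = K (\<lambda>x. (\<psi> x)\<^sup>2) y - 2 * \<psi> y * K \<psi> y + (\<psi> y)\<^sup>2"
      unfolding K_def using continuous_integrable[OF continuous_mult_q[OF c]]
        continuous_integrable[OF continuous_mult_q[OF c2]] continuous_integrable[OF q_left]
      by (simp add: q_integral)
    finally show ?thesis by simp
  qed
  have "2 * (\<integral>y. \<psi> y * K \<psi> y \<partial>\<mu>) = (\<integral>y. 2 * (\<psi> y * K \<psi> y) \<partial>\<mu>)" by simp
  also have "\<dots> \<le> (\<integral>y. K (\<lambda>x. (\<psi> x)\<^sup>2) y + (\<psi> y)\<^sup>2 \<partial>\<mu>)"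
    by (intro integral_mono continuous_integrable continuous_intros c cK cK2 pt)
  also have "\<dots> = 2 * (\<integral>y. (\<psi> y)\<^sup>2 \<partial>\<mu>)"
    using continuous_integrable[OF cK2] continuous_integrable[OF c2] integral_K[OF c2] by simp
  finally show ?thesis by simp
qed

lemma Poisson_pairing_bounds:
  assumes c: "continuous_on UNIV \<psi>" and eq: "\<And>y. \<psi> y - K \<psi> y = \<phi> y"
    and \<phi>: "\<And>x. \<bar>\<phi> x\<bar> \<le> B" and \<psi>: "\<And>x. \<bar>\<psi> x\<bar> \<le> B / \<delta>"
  shows "0 \<le> (\<integral>x. \<phi> x * \<psi> x \<partial>\<mu>)" and "(\<integral>x. \<phi> x * \<psi> x \<partial>\<mu>) \<le> B\<^sup>2 / \<delta>"
proof -
  have cK: "continuous_on UNIV (K \<psi>)" by (intro continuous_K continuous_integrable c)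
  have i1: "integrable \<mu> (\<lambda>x. (\<psi> x)\<^sup>2)" and i2: "integrable \<mu> (\<lambda>x. \<psi> x * K \<psi> x)"
    by (intro continuous_integrable continuous_intros c cK)+
  have "\<phi> x * \<psi> x = (\<psi> x)\<^sup>2 - \<psi> x * K \<psi> x" for x
    unfolding eq[symmetric] by (simp add: power2_eq_square algebra_simps)
  then have e: "(\<lambda>x. \<phi> x * \<psi> x) = (\<lambda>x. (\<psi> x)\<^sup>2 - \<psi> x * K \<psi> x)" by auto
  show "0 \<le> (\<integral>x. \<phi> x * \<psi> x \<partial>\<mu>)"
    unfolding e using i1 i2 integral_mult_K_le[OF c] by simp
  have "\<phi> x * \<psi> x \<le> B\<^sup>2 / \<delta>" for x
  proof -
    have "\<phi> x * \<psi> x \<le> \<bar>\<phi> x\<bar> * \<bar>\<psi> x\<bar>" by (metis abs_ge_self abs_mult)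
    also have "\<dots> \<le> B * (B / \<delta>)" using \<phi>[of x] \<psi>[of x] by (intro mult_mono) auto
    finally show ?thesis by (simp add: power2_eq_square)
  qed
  then have "(\<integral>x. \<phi> x * \<psi> x \<partial>\<mu>) \<le> (\<integral>x. B\<^sup>2 / \<delta> \<partial>\<mu>)"
    using i1 i2 by (intro integral_mono) (auto simp: e)
  then show "(\<integral>x. \<phi> x * \<psi> x \<partial>\<mu>) \<le> B\<^sup>2 / \<delta>" by (simp add: prob_space)
qed

end


section \<open>The inverse modulo constants\<close>

context prob_space
begin

lemma L2_integrable: "\<phi> \<in> L2 M \<Longrightarrow> integrable M \<phi>"
  unfolding L2_def by (auto intro: square_integrable_imp_integrable)

lemma equiv_eq_mod_const: "equiv (L2 M) (eq_mod_const M)"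
proof (rule equivI)
  show "refl_on (L2 M) (eq_mod_const M)"
    unfolding refl_on_def eq_mod_const_def by (auto intro!: exI[of _ 0])
  show "sym (eq_mod_const M)"
  proof (rule symI)
    fix \<phi> \<psi> assume "(\<phi>, \<psi>) \<in> eq_mod_const M"
    then obtain r where r: "\<phi> \<in> L2 M" "\<psi> \<in> L2 M" "AE x in M. \<phi> x = \<psi> x + r"
      unfolding eq_mod_const_def by blast
    from r(3) have "AE x in M. \<psi> x = \<phi> x + - r" by eventually_elim simp
    with r show "(\<psi>, \<phi>) \<in> eq_mod_const M" unfolding eq_mod_const_def by blast
  qed
  show "trans (eq_mod_const M)"
  proof (rule transI)
    fix \<phi> \<psi> \<xi> assume "(\<phi>, \<psi>) \<in> eq_mod_const M" "(\<psi>, \<xi>) \<in> eq_mod_const M"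
    then obtain r s where r: "\<phi> \<in> L2 M" "\<xi> \<in> L2 M"
      "AE x in M. \<phi> x = \<psi> x + r" "AE x in M. \<psi> x = \<xi> x + s"
      unfolding eq_mod_const_def by blast
    from r(3,4) have "AE x in M. \<phi> x = \<xi> x + (s + r)" by eventually_elim simp
    with r(1,2) show "(\<phi>, \<xi>) \<in> eq_mod_const M" unfolding eq_mod_const_def by blast
  qed
qed (auto simp: eq_mod_const_def)

end

context compact_prob_space
begin

lemma L2_continuous: "continuous_on UNIV \<phi> \<Longrightarrow> \<phi> \<in> L2 \<mu>"
  unfolding L2_def by (auto intro!: continuous_measurable continuous_integrable continuous_intros)

lemma L2_diff_continuous:
  assumes \<phi>: "\<phi> \<in> L2 \<mu>" and \<xi>: "continuous_on UNIV \<xi>"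
  shows "(\<lambda>x. \<phi> x - \<xi> x) \<in> L2 \<mu>"
proof -
  have "integrable \<mu> (\<lambda>x. (\<phi> x)\<^sup>2 - 2 * (\<phi> x * \<xi> x) + (\<xi> x)\<^sup>2)"
    using \<phi> integrable_mult_continuous[OF L2_integrable[OF \<phi>] \<xi>] L2_continuous[OF \<xi>]
    by (auto simp: L2_def)
  moreover have "(\<lambda>x. (\<phi> x)\<^sup>2 - 2 * (\<phi> x * \<xi> x) + (\<xi> x)\<^sup>2) = (\<lambda>x. (\<phi> x - \<xi> x)\<^sup>2)"
    by (auto simp: power2_diff)
  ultimately show ?thesis
    using \<phi> continuous_measurable[OF \<xi>] by (auto simp: L2_def)
qed

text \<open>Representatives differ almost everywhere by a constant, which a \<open>\<phi>\<close> of
  mean zero annihilates; the set under \<open>the_elem\<close> is thus a singleton.\<close>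

lemma L2_pairing_class:
  assumes \<phi>: "continuous_on UNIV \<phi>" "(\<integral>x. \<phi> x \<partial>\<mu>) = 0" and \<psi>: "\<psi> \<in> L2 \<mu>"
  shows "L2_pairing \<mu> \<phi> (eq_mod_const \<mu> `` {\<psi>}) = (\<integral>x. \<phi> x * \<psi> x \<partial>\<mu>)"
proof -
  have "(\<integral>x. \<phi> x * \<xi> x \<partial>\<mu>) = (\<integral>x. \<phi> x * \<psi> x \<partial>\<mu>)" if rel: "(\<psi>, \<xi>) \<in> eq_mod_const \<mu>" for \<xi>
  proof -
    obtain r where r: "\<xi> \<in> L2 \<mu>" "AE x in \<mu>. \<psi> x = \<xi> x + r"
      using rel unfolding eq_mod_const_def by blast
    have i1: "integrable \<mu> (\<lambda>x. \<phi> x * \<xi> x)" and i2: "integrable \<mu> (\<lambda>x. \<phi> x * \<psi> x)"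
      using integrable_mult_continuous[OF L2_integrable[OF r(1)] \<phi>(1)]
        integrable_mult_continuous[OF L2_integrable[OF \<psi>] \<phi>(1)]
      by (simp_all add: mult.commute)
    have "(\<integral>x. \<phi> x * \<psi> x \<partial>\<mu>) = (\<integral>x. \<phi> x * \<xi> x + \<phi> x * r \<partial>\<mu>)"
    proof (rule integral_cong_AE)
      show "AE x in \<mu>. \<phi> x * \<psi> x = \<phi> x * \<xi> x + \<phi> x * r"
        using r(2) by eventually_elim (simp add: distrib_left)
      show "(\<lambda>x. \<phi> x * \<xi> x + \<phi> x * r) \<in> borel_measurable \<mu>"
        using i1 continuous_measurable[OF \<phi>(1)] by measurable
    qed (use i2 in blast)
    also have "\<dots> = (\<integral>x. \<phi> x * \<xi> x \<partial>\<mu>)"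
      using i1 continuous_integrable[OF \<phi>(1)] \<phi>(2) by simp
    finally show ?thesis by simp
  qed
  moreover have "\<psi> \<in> eq_mod_const \<mu> `` {\<psi>}" using equiv_class_self[OF equiv_eq_mod_const \<psi>] .
  ultimately show ?thesis
    unfolding L2_pairing_def by (intro the_elem_image_unique) blast+
qed

end

context doeblin_kernel
begin

text \<open>The integral ignores null sets and \<open>K\<close> fixes constants, so an almost
  everywhere relation becomes an identity at every point.\<close>

lemma K_eq_mod_const:
  assumes "integrable \<mu> \<phi>" "integrable \<mu> \<psi>" and ae: "AE x in \<mu>. \<phi> x = \<psi> x + r"
  shows "K \<phi> y = K \<psi> y + r"
proof -
  have "K \<phi> y = K (\<lambda>x. \<psi> x + r) y" unfolding K_def
  proof (rule integral_cong_AE)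
    show "AE x in \<mu>. \<phi> x * q x y = (\<psi> x + r) * q x y" using ae by eventually_elim simp
    show "(\<lambda>x. \<phi> x * q x y) \<in> borel_measurable \<mu>" "(\<lambda>x. (\<psi> x + r) * q x y) \<in> borel_measurable \<mu>"
      using assms(1,2) continuous_measurable[OF q_left] by measurable
  qed
  then show ?thesis using K_add[OF assms(2), of "\<lambda>_. r"] by (simp add: K_const)
qed

lemma L2_diff_K: "\<phi> \<in> L2 \<mu> \<Longrightarrow> (\<lambda>x. \<phi> x - K \<phi> x) \<in> L2 \<mu>"
  by (intro L2_diff_continuous continuous_K L2_integrable)

text \<open>\<open>id_minus_K\<close> is a union over all representatives; their images are
  equivalent, so the union collapses to a single class.\<close>

lemma id_minus_K_class:
  assumes K: "K_mu \<epsilon> c \<mu> = K" and \<psi>: "\<psi> \<in> L2 \<mu>"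
  shows "id_minus_K \<epsilon> c \<mu> (eq_mod_const \<mu> `` {\<psi>}) = eq_mod_const \<mu> `` {\<lambda>x. \<psi> x - K \<psi> x}"
proof -
  have "eq_mod_const \<mu> `` {\<lambda>x. \<xi> x - K \<xi> x} = eq_mod_const \<mu> `` {\<lambda>x. \<psi> x - K \<psi> x}"
    if rel: "(\<psi>, \<xi>) \<in> eq_mod_const \<mu>" for \<xi>
  proof -
    obtain r where r: "\<xi> \<in> L2 \<mu>" "AE x in \<mu>. \<psi> x = \<xi> x + r"
      using rel unfolding eq_mod_const_def by blast
    have "K \<psi> y = K \<xi> y + r" for y
      using K_eq_mod_const L2_integrable \<psi> r by blast
    then have "AE x in \<mu>. \<xi> x - K \<xi> x = \<psi> x - K \<psi> x + 0"
      using r(2) by (auto elim!: eventually_mono)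
    then have "(\<lambda>x. \<xi> x - K \<xi> x, \<lambda>x. \<psi> x - K \<psi> x) \<in> eq_mod_const \<mu>"
      using L2_diff_K r(1) \<psi> unfolding eq_mod_const_def by blast
    then show ?thesis by (rule equiv_class_eq[OF equiv_eq_mod_const])
  qed
  moreover have "\<psi> \<in> eq_mod_const \<mu> `` {\<psi>}" using equiv_class_self[OF equiv_eq_mod_const \<psi>] .
  ultimately show ?thesis unfolding id_minus_K_def K by blast
qed

text \<open>\<open>the_inv_into\<close> is a definite description, so besides the solution
  \<open>\<psi>\<close> it must be shown that no other \<open>L2\<close> class, continuous or not,
  is mapped to the class of \<open>\<phi>\<close>.\<close>

lemma id_minus_K_inverse_class:
  assumes K: "K_mu \<epsilon> c \<mu> = K" and \<psi>: "continuous_on UNIV \<psi>" and eq: "\<And>y. \<psi> y - K \<psi> y = \<phi> y"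
  shows "id_minus_K_inverse \<epsilon> c \<mu> (eq_mod_const \<mu> `` {\<phi>}) = eq_mod_const \<mu> `` {\<psi>}"
proof -
  have \<psi>2: "\<psi> \<in> L2 \<mu>" by (rule L2_continuous[OF \<psi>])
  have \<phi>: "\<phi> = (\<lambda>x. \<psi> x - K \<psi> x)" by (simp add: eq)
  show ?thesis
    unfolding id_minus_K_inverse_def the_inv_into_def
  proof (rule the_equality)
    show "eq_mod_const \<mu> `` {\<psi>} \<in> L2_mod_const \<mu> \<and>
        id_minus_K \<epsilon> c \<mu> (eq_mod_const \<mu> `` {\<psi>}) = eq_mod_const \<mu> `` {\<phi>}"
      unfolding L2_mod_const_def \<phi> using id_minus_K_class[OF K \<psi>2] quotientI[OF \<psi>2] by blast
    fix U assume U: "U \<in> L2_mod_const \<mu> \<and> id_minus_K \<epsilon> c \<mu> U = eq_mod_const \<mu> `` {\<phi>}"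
    then obtain \<xi> where \<xi>: "\<xi> \<in> L2 \<mu>" "U = eq_mod_const \<mu> `` {\<xi>}"
      unfolding L2_mod_const_def by (auto elim: quotientE)
    have "eq_mod_const \<mu> `` {\<lambda>x. \<xi> x - K \<xi> x} = eq_mod_const \<mu> `` {\<lambda>x. \<psi> x - K \<psi> x}"
      using U id_minus_K_class[OF K \<xi>(1)] unfolding \<xi>(2) \<phi> by simp
    then have "(\<lambda>x. \<xi> x - K \<xi> x, \<lambda>x. \<psi> x - K \<psi> x) \<in> eq_mod_const \<mu>"
      using eq_equiv_class[OF _ equiv_eq_mod_const L2_diff_K[OF \<psi>2]] by blast
    then obtain r where r: "AE x in \<mu>. \<xi> x - K \<xi> x = \<psi> x - K \<psi> x + r"
      unfolding eq_mod_const_def by blast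
    \<comment> \<open>\<open>\<xi>\<close> may be discontinuous, but \<open>\<xi> - \<psi>\<close>
      agrees almost everywhere with \<open>\<eta>\<close>, which is continuous as it involves
      \<open>\<xi>\<close> and \<open>\<psi>\<close> only through \<open>K\<close>. Applying
      \<open>K\<close> then brings \<open>\<eta>\<close> under
      \<open>harmonic_constant\<close>.\<close>
    define \<eta> where "\<eta> x = K \<xi> x - K \<psi> x + r" for x
    have i\<xi>: "integrable \<mu> \<xi>" and i\<psi>: "integrable \<mu> \<psi>"
      using L2_integrable \<xi>(1) \<psi>2 by blast+
    have c\<eta>: "continuous_on UNIV \<eta>"
      unfolding \<eta>_def[abs_def] by (intro continuous_intros continuous_K i\<xi> i\<psi>)
    have ae: "AE x in \<mu>. \<xi> x = \<psi> x + \<eta> x"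
      using r by eventually_elim (simp add: \<eta>_def)
    have "K \<xi> y = K (\<lambda>x. \<psi> x + \<eta> x) y" for y
      using K_eq_mod_const[OF i\<xi>, of "\<lambda>x. \<psi> x + \<eta> x" 0] ae i\<psi> continuous_integrable[OF c\<eta>] by simp
    then have "K \<xi> y = K \<psi> y + K \<eta> y" for y
      by (simp only: K_add[OF i\<psi> continuous_integrable[OF c\<eta>]])
    then have "\<eta> y = K \<eta> y + r" for y
      by (simp add: \<eta>_def[of y])
    then obtain s where "\<And>y. \<eta> y = s" using harmonic_constant[OF c\<eta>] by blast
    then have "AE x in \<mu>. \<xi> x = \<psi> x + s" using ae by simp
    then have "(\<xi>, \<psi>) \<in> eq_mod_const \<mu>" using \<xi>(1) \<psi>2 unfolding eq_mod_const_def by blast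
    then show "U = eq_mod_const \<mu> `` {\<psi>}"
      unfolding \<xi>(2) by (rule equiv_class_eq[OF equiv_eq_mod_const])
  qed
qed

end


section \<open>Bounds on the metric tensor\<close>

context compact_prob_space
begin

text \<open>With \<open>I\<close> the integral of \<open>exp f\<close>, the equation gives
  \<open>exp (f x) * (l * I) \<le> 1 \<le> exp (f x) * I\<close>. Integrating again yields
  \<open>1 \<le> I * I\<close> and \<open>I * I * l \<le> 1\<close>. The former bounds
  \<open>exp f\<close> from above; the latter bounds the product of two values below by
  \<open>l\<close>, and \<open>k\<close> supplies the other factor \<open>l\<close>.\<close>

lemma scaling_bounds:
  fixes k :: "'a \<Rightarrow> 'a \<Rightarrow> real"
  assumes k: "continuous_on UNIV (\<lambda>(x, y). k x y)" and l: "0 < l" "\<And>x y. l \<le> k x y" "\<And>x y. k x y \<le> 1"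
    and f: "continuous_on UNIV f" "\<And>y. exp (f y) * (\<integral>x. exp (f x) * k x y \<partial>\<mu>) = 1"
  shows "exp (f x) \<le> 1 / l" and "l\<^sup>2 \<le> exp (f x) * exp (f y) * k x y"
proof -
  define I where "I = (\<integral>x. exp (f x) \<partial>\<mu>)"
  note b = integral_exp_kernel_bounds[OF k l f(1), folded I_def]
  have ie: "integrable \<mu> (\<lambda>x. exp (f x))" by (intro continuous_integrable continuous_intros f(1))
  have l1: "l \<le> 1" using l(2,3) order_trans by blast
  have I0: "0 < I" by (rule b(1))
  have up: "exp (f x) * (l * I) \<le> 1" for x
    using mult_left_mono[OF b(2)[of x], of "exp (f x)"] by (simp add: f(2))
  have lo: "1 \<le> exp (f x) * I" for x
    using mult_left_mono[OF b(3)[of x], of "exp (f x)"] by (simp add: f(2))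
  have "(\<integral>x. 1 \<partial>\<mu>) \<le> (\<integral>x. exp (f x) * I \<partial>\<mu>)"
    using ie lo by (intro integral_mono) auto
  then have I1: "1 \<le> I * I" by (simp add: prob_space I_def)
  have "(\<integral>x. exp (f x) * (l * I) \<partial>\<mu>) \<le> (\<integral>x. 1 \<partial>\<mu>)"
    using ie up by (intro integral_mono) auto
  then have I2: "I * I * l \<le> 1" by (simp add: prob_space I_def[symmetric] mult_ac)
  have "1 \<le> I" using I1 I0 by (smt (verit) mult_less_cancel_right1)
  then have "exp (f x) * l * 1 \<le> exp (f x) * l * I" using l(1) by (intro mult_left_mono) auto
  also have "\<dots> \<le> 1" using up[of x] by (simp add: mult_ac)
  finally show "exp (f x) \<le> 1 / l" using l(1) by (simp add: field_simps)
  have "1 * 1 \<le> (exp (f x) * I) * (exp (f y) * I)" using I0 by (intro mult_mono lo) auto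
  then have "l * 1 \<le> l * ((exp (f x) * I) * (exp (f y) * I))"
    using l(1) by (intro mult_left_mono) auto
  also have "\<dots> = exp (f x) * exp (f y) * (I * I * l)" by (simp add: mult_ac)
  also have "\<dots> \<le> exp (f x) * exp (f y) * 1" by (intro mult_left_mono I2) auto
  finally have "l \<le> exp (f x) * exp (f y)" by simp
  then show "l\<^sup>2 \<le> exp (f x) * exp (f y) * k x y"
    unfolding power2_eq_square using l by (intro mult_mono) auto
qed

text \<open>The potential is a definite description, so its properties become available only through
  existence and uniqueness. Both are transferred from the scaling by rewriting the equation for
  \<open>f / \<epsilon>\<close>.\<close>

lemma self_potential_characterisation:
  fixes c :: "'a \<Rightarrow> 'a \<Rightarrow> real"
  assumes \<epsilon>: "0 < \<epsilon>" and k: "continuous_on UNIV (\<lambda>(x, y). gibbs_kernel \<epsilon> c x y)"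
    and l: "0 < l" "\<And>x y. l \<le> gibbs_kernel \<epsilon> c x y" "\<And>x y. gibbs_kernel \<epsilon> c x y \<le> 1"
  shows "continuous_on UNIV (\<lambda>x. self_potential \<epsilon> c \<mu> x / \<epsilon>)"
    and "exp (self_potential \<epsilon> c \<mu> y / \<epsilon>)
      * (\<integral>x. exp (self_potential \<epsilon> c \<mu> x / \<epsilon>) * gibbs_kernel \<epsilon> c x y \<partial>\<mu>) = 1"
proof -
  define P where "P f \<longleftrightarrow> continuous_on UNIV f \<and>
     (\<forall>y. (\<integral>x. exp (1 / \<epsilon> * (f x + f y - c x y)) \<partial>\<mu>) = 1)" for f :: "'a \<Rightarrow> real"
  have P_iff: "P f \<longleftrightarrow> continuous_on UNIV (\<lambda>x. f x / \<epsilon>) \<and>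
     (\<forall>y. exp (f y / \<epsilon>) * (\<integral>x. exp (f x / \<epsilon>) * gibbs_kernel \<epsilon> c x y \<partial>\<mu>) = 1)" for f
  proof -
    have "continuous_on UNIV f \<longleftrightarrow> continuous_on UNIV (\<lambda>x. f x / \<epsilon>)"
    proof
      assume "continuous_on UNIV (\<lambda>x. f x / \<epsilon>)"
      then have "continuous_on UNIV (\<lambda>x. \<epsilon> * (f x / \<epsilon>))" by (rule continuous_on_mult_left)
      then show "continuous_on UNIV f" using \<epsilon> by simp
    qed (use \<epsilon> in \<open>auto intro!: continuous_intros\<close>)
    moreover have "exp (1 / \<epsilon> * (f x + f y - c x y))
        = exp (f y / \<epsilon>) * (exp (f x / \<epsilon>) * gibbs_kernel \<epsilon> c x y)" for x y
      by (simp add: gibbs_kernel_def add_divide_distrib diff_divide_distrib flip: exp_add)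
    then have "(\<integral>x. exp (1 / \<epsilon> * (f x + f y - c x y)) \<partial>\<mu>)
        = exp (f y / \<epsilon>) * (\<integral>x. exp (f x / \<epsilon>) * gibbs_kernel \<epsilon> c x y \<partial>\<mu>)" for y by simp
    ultimately show ?thesis unfolding P_def by simp
  qed
  obtain g where g: "continuous_on UNIV g" "\<And>y. exp (g y) * (\<integral>x. exp (g x) * gibbs_kernel \<epsilon> c x y \<partial>\<mu>) = 1"
    using exists_scaling[OF k l] by blast
  have Pg: "P (\<lambda>x. \<epsilon> * g x)" unfolding P_iff using g \<epsilon> by simp
  have "f1 = f2" if "P f1" "P f2" for f1 f2
  proof -
    have "(\<lambda>x. f1 x / \<epsilon>) = (\<lambda>x. f2 x / \<epsilon>)"
      using that unfolding P_iff by (intro scaling_unique[OF k less_le_trans[OF l(1,2)]]) auto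
    then show ?thesis using \<epsilon> by (simp add: fun_eq_iff)
  qed
  then have "P (self_potential \<epsilon> c \<mu>)"
    unfolding self_potential_def P_def[symmetric] using Pg by (intro theI[of P]) blast+
  then show "continuous_on UNIV (\<lambda>x. self_potential \<epsilon> c \<mu> x / \<epsilon>)"
    and "exp (self_potential \<epsilon> c \<mu> y / \<epsilon>)
      * (\<integral>x. exp (self_potential \<epsilon> c \<mu> x / \<epsilon>) * gibbs_kernel \<epsilon> c x y \<partial>\<mu>) = 1"
    unfolding P_iff by blast+
qed

end

theorem proposition4p15:
  fixes c :: "'a::metric_space \<Rightarrow> 'a \<Rightarrow> real"
    and \<epsilon> :: real
    and H :: "('a \<Rightarrow> real) set"
    and ip :: "('a \<Rightarrow> real) \<Rightarrow> ('a \<Rightarrow> real) \<Rightarrow> real"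
    and \<mu> :: "'a measure"
    and \<beta> :: "'a \<Rightarrow> real"
  assumes compact_X: "compact (UNIV :: 'a set)"
    and eps_pos: "\<epsilon> > 0"
    and c_cont: "continuous_on UNIV (\<lambda>(x, y). c x y)"
    and c_nonneg: "\<And>x y. 0 \<le> c x y"
    and c_sym: "\<And>x y. c x y = c y x"
    and k_pd: "pos_def_kernel (gibbs_kernel \<epsilon> c)"
    and H_rkhs: "rkhs (gibbs_kernel \<epsilon> c) H ip"
    and k_universal: "dense_in_continuous H"
    and mu_borel: "sets \<mu> = sets borel"
    and mu_prob: "prob_space \<mu>"
    and beta_mem: "\<beta> \<in> H"
    and beta_orth: "ip (B_embed \<epsilon> c \<mu>) \<beta> = 0"
  shows "\<epsilon> / 2 * (ip_norm ip \<beta>)\<^sup>2 \<le> metric_tensor \<epsilon> c ip \<mu> \<beta> \<and>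
         metric_tensor \<epsilon> c ip \<mu> \<beta>
           \<le> (1 + 2 * exp (11 / (2 * \<epsilon>) * sup_norm c)) * (\<epsilon> / 2 * (ip_norm ip \<beta>)\<^sup>2)"
proof -
  interpret prob_space \<mu> by fact
  interpret compact_prob_space \<mu> by unfold_locales fact+
  interpret rkhs "gibbs_kernel \<epsilon> c" H ip by fact
  define C where "C = sup_norm c"
  define l where "l = exp (- C / \<epsilon>)"
  define a where "a = scaling \<epsilon> c \<mu>"
  define N where "N = ip_norm ip \<beta>"
  define \<phi> where "\<phi> = (\<lambda>x. a x * \<beta> x)"

  have cC: "c x y \<le> C" for x y
  proof -
    obtain B where "\<And>x y. \<bar>c x y\<bar> \<le> B" using kernel_bounded[OF c_cont] by blast
    then have "bdd_above (range (\<lambda>(x, y). \<bar>c x y\<bar>))" by (intro bdd_aboveI[of _ B]) auto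
    from cSUP_upper[OF _ this, of "(x, y)"] show ?thesis by (simp add: C_def sup_norm_def)
  qed
  have C0: "0 \<le> C" using c_nonneg cC order_trans by blast
  have k: "continuous_on UNIV (\<lambda>(x, y). gibbs_kernel \<epsilon> c x y)"
    using c_cont eps_pos unfolding gibbs_kernel_def case_prod_beta'
    by (intro continuous_intros) auto
  have l: "0 < l" "\<And>x y. l \<le> gibbs_kernel \<epsilon> c x y" "\<And>x y. gibbs_kernel \<epsilon> c x y \<le> 1"
    using cC c_nonneg eps_pos by (auto simp: l_def gibbs_kernel_def divide_right_mono)
  note pot = self_potential_characterisation[OF eps_pos k l]
  note bounds = scaling_bounds[OF k l pot]
  have ca: "continuous_on UNIV a"
    unfolding a_def scaling_def[abs_def] by (intro continuous_intros pot(1))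
  have a0: "0 \<le> a x" and a_le: "a x \<le> 1 / l" for x
    using bounds(1) by (simp_all add: a_def scaling_def)
  have Hc: "continuous_on UNIV h" if "h \<in> H" for h
    using k_universal that by (simp add: dense_in_continuous_def)
  have c\<phi>: "continuous_on UNIV \<phi>"
    unfolding \<phi>_def by (intro continuous_on_mult ca Hc beta_mem)
  \<comment> \<open>Orthogonality in \<open>H\<close> becomes mean zero because pairing with the
    mean embedding \<open>B_embed\<close> integrates against \<open>a\<close>.\<close>
  have mean: "(\<integral>x. \<phi> x \<partial>\<mu>) = 0"
    using kernel_mean_embedding(2)[OF H_rkhs k Hc ca beta_mem] beta_orth
    by (simp add: B_embed_def a_def \<phi>_def)
  have \<phi>_le: "\<bar>\<phi> x\<bar> \<le> N / l" for x
  proof -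
    have "\<bar>\<phi> x\<bar> = a x * \<bar>\<beta> x\<bar>" using a0 by (simp add: \<phi>_def abs_mult)
    also have "\<dots> \<le> 1 / l * N"
      using a_le a0 evaluation_bound[OF beta_mem l(3)] l(1) unfolding N_def by (intro mult_mono) auto
    finally show ?thesis by simp
  qed

  interpret D: doeblin_kernel \<mu> "k_mu \<epsilon> c \<mu>" "l\<^sup>2"
  proof unfold_locales
    have "continuous_on UNIV (\<lambda>p::'a \<times> 'a. a (fst p))" "continuous_on UNIV (\<lambda>p::'a \<times> 'a. a (snd p))"
      using continuous_on_compose2[OF ca, of UNIV fst] continuous_on_compose2[OF ca, of UNIV snd]
      by (simp_all add: continuous_intros)
    then show "continuous_on UNIV (\<lambda>(x, y). k_mu \<epsilon> c \<mu> x y)"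
      using k unfolding k_mu_def a_def[symmetric] case_prod_beta' by (intro continuous_on_mult)
    show "k_mu \<epsilon> c \<mu> x y = k_mu \<epsilon> c \<mu> y x" for x y
      by (simp add: k_mu_def gibbs_kernel_def c_sym[of x y])
    show "0 < l\<^sup>2" using l(1) by simp
    show "l\<^sup>2 \<le> k_mu \<epsilon> c \<mu> x y" for x y
      using bounds(2) by (simp add: k_mu_def scaling_def)
    have "(\<integral>x. k_mu \<epsilon> c \<mu> x y \<partial>\<mu>) = (\<integral>x. a y * (a x * gibbs_kernel \<epsilon> c x y) \<partial>\<mu>)" for y
      by (simp add: k_mu_def a_def mult_ac)
    then show "(\<integral>x. k_mu \<epsilon> c \<mu> x y \<partial>\<mu>) = 1" for y
      using pot(2)[of y] by (simp add: a_def scaling_def)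
  qed
  have K: "K_mu \<epsilon> c \<mu> = D.K" by (simp add: fun_eq_iff K_mu_def D.K_def)
  obtain \<psi> where \<psi>: "continuous_on UNIV \<psi>" "\<And>y. \<psi> y - D.K \<psi> y = \<phi> y"
    "\<And>x. \<bar>\<psi> x\<bar> \<le> N / l / l\<^sup>2"
    using D.Poisson_equation[OF c\<phi> mean \<phi>_le] by blast
  define p where "p = (\<integral>x. \<phi> x * \<psi> x \<partial>\<mu>)"
  have g: "metric_tensor \<epsilon> c ip \<mu> \<beta> = \<epsilon> / 2 * (N\<^sup>2 + 2 * p)"
    using D.id_minus_K_inverse_class[OF K \<psi>(1,2)] L2_pairing_class[OF c\<phi> mean L2_continuous[OF \<psi>(1)]]
    by (simp add: metric_tensor_def Let_def N_def p_def \<phi>_def a_def)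
  have p0: "0 \<le> p" and p1: "p \<le> (N / l)\<^sup>2 / l\<^sup>2"
    using D.Poisson_pairing_bounds[OF \<psi>(1,2) \<phi>_le \<psi>(3)] by (simp_all add: p_def)
  \<comment> \<open>Two factors \<open>1 / l\<close> come from \<open>a \<le> 1 / l\<close>, which
    enters through both \<open>\<phi>\<close> and \<open>\<psi>\<close>; the other two come from the
    Doeblin constant, the square of \<open>l\<close>.\<close>
  have "(N / l)\<^sup>2 / l\<^sup>2 = 1 / l ^ 4 * N\<^sup>2"
    by (simp add: power_divide power_add[symmetric])
  also have "1 / l ^ 4 = exp (4 * C / \<epsilon>)"
  proof -
    have "l ^ 4 = exp (- (4 * C / \<epsilon>))" by (simp add: l_def flip: exp_of_nat_mult)
    then show ?thesis by (simp add: exp_minus inverse_eq_divide)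
  qed
  also have "exp (4 * C / \<epsilon>) \<le> exp (11 / (2 * \<epsilon>) * C)"
    using C0 eps_pos by (simp add: field_simps)
  finally have p2: "p \<le> exp (11 / (2 * \<epsilon>) * C) * N\<^sup>2"
    using p1 by (simp add: mult_right_mono)
  have "\<epsilon> / 2 * N\<^sup>2 \<le> \<epsilon> / 2 * (N\<^sup>2 + 2 * p)"
    using p0 eps_pos by (intro mult_left_mono) auto
  moreover have "\<epsilon> / 2 * (N\<^sup>2 + 2 * p) \<le> \<epsilon> / 2 * ((1 + 2 * exp (11 / (2 * \<epsilon>) * C)) * N\<^sup>2)"
    using p2 eps_pos by (intro mult_left_mono) (auto simp: distrib_right)
  ultimately show ?thesis
    unfolding g N_def[symmetric] C_def[symmetric] by (simp add: mult_ac)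
qed

end
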